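(* Let $A\in GL_n(\mathbb{R})$ be in real Jordan normal form, and consider the discrete action $\gamma\mapsto \gamma A^k$ $(k\in\mathbb{Z})$ on $\widehat{\mathbb{R}^n}$. (1) There exists a cross-section for this action if and only if $A$ is not orthogonal. (2) There exists a cross-section of finite Lebesgue measure for this action if and only if $|\det(A)|\neq 1$. (3) There exists a bounded cross-section for this action if and only if the (real or complex) eigenvalues of $A$ all have modulus $>1$ or all have modulus $<1$.
   Context: $\widehat{\mathbb{R}^n}$ denotes $\mathbb{R}^n$ regarded as a space of row vectors, so matrices act on it by right multiplication. For $S\subset \widehat{\mathbb{R}^n}$, $SA^k=\{\gamma A^k:\gamma\in S\}$. A Borel set $S \subset \widehat{\mathbb{R}^n}$ is called a cross-section for the discrete action $\gamma \mapsto \gamma A^k$ $(k\in\mathbb{Z})$ if (1) $\bigcup_{k\in\mathbb{Z}} SA^k = \widehat{\mathbb{R}^n}\setminus N$ for some set $N$ of Lebesgue measure zero, and (2) $SA^{j}\cap SA^{k}=\emptyset$ whenever $j\neq k\in\mathbb{Z}$. Real Jordan normal form: the matrix is block diagonal; a block corresponding to a real eigenvalue $\alpha$ has $\alpha$ on the diagonal, $1$ on the superdiagonal and $0$ elsewhere; a block corresponding to a pair of complex eigenvalues $\alpha\pm i\beta$, $\beta\neq 0$, is a block upper triangular matrix made of $2\times 2$ blocks with $D=\begin{pmatrix}\alpha&\beta\\-\beta&\alpha\end{pmatrix}$ on the block diagonal, the identity $I_2$ on the block superdiagonal, and $0$ elsewhere. *)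

theory Defs
  imports "HOL-Analysis.Analysis" "Jordan_Normal_Form.Jordan_Normal_Form"
begin

(* HOL-Analysis matrices are used for the measure-theoretic part and Jordan_Normal_Form matrices
   for block structure and eigenvalues.  Both libraries define det and mat, hence the qualified
   names below. *)

primrec matrix_pow :: "real^'n^'n \<Rightarrow> nat \<Rightarrow> real^'n^'n" where
  "matrix_pow A 0 = Finite_Cartesian_Product.mat 1"
| "matrix_pow A (Suc k) = A ** matrix_pow A k"

definition matrix_powi :: "real^'n^'n \<Rightarrow> int \<Rightarrow> real^'n^'n" where
  "matrix_powi A k = (if 0 \<le> k then matrix_pow A (nat k) else matrix_pow (matrix_inv A) (nat (- k)))"

definition translate :: "(real^'n) set \<Rightarrow> real^'n^'n \<Rightarrow> int \<Rightarrow> (real^'n) set" where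
  "translate S A k = (\<lambda>\<gamma>. \<gamma> v* matrix_powi A k) ` S"

definition cross_section :: "real^'n^'n \<Rightarrow> (real^'n) set \<Rightarrow> bool" where
  "cross_section A S \<longleftrightarrow>
     S \<in> sets borel \<and>
     (\<exists>N \<in> null_sets lebesgue. (\<Union>k. translate S A k) = UNIV - N) \<and>
     (\<forall>j k. j \<noteq> k \<longrightarrow> translate S A j \<inter> translate S A k = {})"

(* The linear order on the index type identifies it with {0..<n}, so that "block diagonal" and
   "superdiagonal" make sense. *)
definition mat_of_matrix :: "real^'n::{finite,linorder}^'n::{finite,linorder} \<Rightarrow> real mat" where
  "mat_of_matrix A =
     Matrix.mat CARD('n) CARD('n)
       (\<lambda>(i, j). A $ (sorted_list_of_set UNIV ! i) $ (sorted_list_of_set UNIV ! j))"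

(* m counts the 2x2 blocks on the diagonal, so the matrix has size 2m. *)
definition complex_jordan_block :: "nat \<Rightarrow> real \<Rightarrow> real \<Rightarrow> real mat" where
  "complex_jordan_block m \<alpha> \<beta> = Matrix.mat (2 * m) (2 * m) (\<lambda>(i, j).
     if i div 2 = j div 2 then
       (if i = j then \<alpha> else if i < j then \<beta> else - \<beta>)
     else if Suc (i div 2) = j div 2 then
       (if i mod 2 = j mod 2 then 1 else 0)
     else 0)"

definition real_jordan_block :: "real mat \<Rightarrow> bool" where
  "real_jordan_block B \<longleftrightarrow>
     (\<exists>m \<alpha>. m > 0 \<and> B = jordan_block m \<alpha>) \<or>
     (\<exists>m \<alpha> \<beta>. m > 0 \<and> \<beta> \<noteq> 0 \<and> B = complex_jordan_block m \<alpha> \<beta>)"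

definition real_jordan_normal_form :: "real^'n::{finite,linorder}^'n::{finite,linorder} \<Rightarrow> bool" where
  "real_jordan_normal_form A \<longleftrightarrow>
     (\<exists>Bs. (\<forall>B \<in> set Bs. real_jordan_block B) \<and> mat_of_matrix A = diag_block_mat Bs)"

definition complex_eigenvalue :: "real^'n::{finite,linorder}^'n::{finite,linorder} \<Rightarrow> complex \<Rightarrow> bool" where
  "complex_eigenvalue A z \<longleftrightarrow> eigenvalue (map_mat complex_of_real (mat_of_matrix A)) z"

end

(* Part 1.  If A v = z v and either |z| is not 1 or A w = z w + v, then a logarithm of |x v|, or
   Re (z (x w) / (x v)), is a function phi with phi (x A) = phi x + 1 off a hyperplane, and
   {0 <= phi < 1} is a cross-section; a real Jordan form that is not orthogonal has such a v.  If A
   is orthogonal, the unit ball is invariant, and its finite measure would be the sum of infinitely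
   many copies of the measure of its intersection with a cross-section.

   Part 2.  If |det A| = 1, all cross-sections have the same measure; as 2 S is one whenever S is,
   this measure is infinite.  Otherwise cut a cross-section into pieces of finite measure and move
   the i-th piece by a power of A that makes its measure at most 2^-i.

   Part 3.  If A^k or A^-k tends to 0, move each point of a cross-section into the unit ball.  For the
   converse see bounded_cross_section_eigenvalue. *)

theory Submission
  imports Defs
begin

no_notation vec_index (infixl "$" 100)
hide_const (open) Determinant.det Matrix.mat Matrix.row

text \<open>Because points are row vectors, (x A) v = x (A v): a column eigenvector of A becomes a
  functional that is merely rescaled along every orbit. Complex functionals are used on the real
  space since the two kinds of real Jordan block then behave alike: each has one chain for one
  eigenvalue, and each of its coordinates is the real or the imaginary part of x paired with a chain
  vector. The only blocks with eigenvalues on the unit circle and a chain of length one are the 1 x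
  1 blocks 1 and -1 and the 2 x 2 rotations, and a block diagonal matrix made of these is
  orthogonal. This is where part 1 depends on the normal form: a matrix merely conjugate to an
  orthogonal one has no cross-section either. The arguments by doubling in parts 2 and 3 share one
  reason: dilations commute with the linear action, while dilation by 2 multiplies volume by 2 to
  the power of the dimension, so no finite positive volume survives the comparison.\<close>

section \<open>Determinants and the measure of linear images\<close>

lemma matrix_shear:
  fixes m n :: "'n::finite"
  shows "matrix (\<lambda>v::real^'n. \<chi> i. if i = m then v$m + v$n else v$i)
    = (\<chi> k. if k = m then row m (Finite_Cartesian_Product.mat 1) + 1 *s row n (Finite_Cartesian_Product.mat 1)
        else row k (Finite_Cartesian_Product.mat 1))"
  by (simp add: Finite_Cartesian_Product.vec_eq_iff matrix_def Finite_Cartesian_Product.row_def Finite_Cartesian_Product.mat_def axis_def)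

text \<open>The library states the next result only for index types that are well-ordered.\<close>

lemma measure_linear_image_cart:
  fixes f :: "real^'n \<Rightarrow> real^'n"
  assumes "linear f" "S \<in> lmeasurable"
  shows "f ` S \<in> lmeasurable \<and> measure lebesgue (f ` S) = \<bar>Determinants.det (matrix f)\<bar> * measure lebesgue S"
proof -
  let ?Q = "\<lambda>f::real^'n \<Rightarrow> real^'n. linear f \<longrightarrow> (\<forall>S\<in>lmeasurable. f ` S \<in> lmeasurable
    \<and> measure lebesgue (f ` S) = \<bar>Determinants.det (matrix f)\<bar> * measure lebesgue S)"
  \<comment> \<open>For the swap and the shear below, both of determinant 1 or -1, it is enough to
    compare measures on boxes.\<close>
  have unimodular: "?Q f" if f: "linear f" and d: "\<bar>Determinants.det (matrix f)\<bar> = 1"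
    and im: "\<And>a b. measure lebesgue (f ` cbox a b) = measure lebesgue (cbox a b)" for f
  proof (intro impI ballI)
    fix S :: "(real^'n) set" assume "S \<in> lmeasurable"
    from measure_linear_sufficient[OF f this, of 1] im
    show "f ` S \<in> lmeasurable \<and> measure lebesgue (f ` S) = \<bar>Determinants.det (matrix f)\<bar> * measure lebesgue S"
      by (simp add: d)
  qed
  have "?Q f"
  proof (rule induct_linear_elementary[OF \<open>linear f\<close>])
    fix f g :: "real^'n \<Rightarrow> real^'n"
    assume "linear f" "linear g" "?Q f" "?Q g"
    then show "?Q (f \<circ> g)"
      by (simp add: image_comp[symmetric] matrix_compose det_mul abs_mult del: o_apply image_comp)
  next
    fix f :: "real^'n \<Rightarrow> real^'n" and i
    assume f: "linear f" and 0: "\<And>x. f x $ i = 0"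
    have "\<not> surj f"
      by (metis "0" one_neq_zero surjD vec_component)
    then have "\<not> inj f"
      using f linear_injective_imp_surjective by blast
    then show "?Q f"
      using f det_nz_iff_inj[OF f] negligible_linear_singular_image[OF f]
      by (auto simp: negligible_imp_measurable negligible_imp_measure0)
  next
    fix c :: "'n \<Rightarrow> real"
    have "matrix (\<lambda>x::real^'n. \<chi> i. c i * x $ i) $ i $ j = (if i = j then c i else 0)" for i j
      by (auto simp: matrix_def axis_def)
    then have "Determinants.det (matrix (\<lambda>x::real^'n. \<chi> i. c i * x $ i)) = prod c UNIV"
      by (subst det_diagonal) auto
    then show "?Q (\<lambda>x. \<chi> i. c i * x $ i)"
      by (simp add: measurable_stretch measure_stretch)
  next
    fix m n :: 'n
    let ?h = "\<lambda>x::real^'n. \<chi> i. x $ Transposition.transpose m n i"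
    have lin: "linear ?h"
      by (rule linearI) (simp_all add: Finite_Cartesian_Product.vec_eq_iff)
    have "?h \<circ> ?h = id" by (auto simp: Finite_Cartesian_Product.vec_eq_iff)
    \<comment> \<open>An involution has determinant of square 1, so the sign of the permutation need
      not be computed.\<close>
    then have "Determinants.det (matrix ?h) * Determinants.det (matrix ?h) = 1"
      by (metis det_I det_mul lin matrix_compose matrix_id_mat_1)
    then have d: "\<bar>Determinants.det (matrix ?h)\<bar> = 1"
      by (metis abs_mult_self_eq abs_one abs_square_eq_1 power2_eq_square)
    have "measure lebesgue (?h ` cbox a b) = measure lebesgue (cbox a b)" for a b
    proof -
      have inv: "?h (?h x) = x" for x by (simp add: Finite_Cartesian_Product.vec_eq_iff)
      have eq: "?h ` cbox a b = cbox (?h a) (?h b)"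
      proof (intro equalityI subsetI)
        fix x assume "x \<in> cbox (?h a) (?h b)"
        then have "?h x \<in> cbox a b"
          by (simp add: mem_box_cart) (metis transpose_involutory)
        then show "x \<in> ?h ` cbox a b" by (metis (no_types) image_eqI inv)
      qed (auto simp: mem_box_cart)
      then have emp: "cbox (?h a) (?h b) = {} \<longleftrightarrow> cbox a b = {}"
        by (metis image_is_empty)
      have pr: "(\<Prod>i\<in>UNIV. b $ Transposition.transpose m n i - a $ Transposition.transpose m n i)
          = (\<Prod>i\<in>UNIV. b $ i - a $ i)"
        using prod.permute[OF permutes_swap_id[of m UNIV n], of "\<lambda>i. b $ i - a $ i"] by (simp add: o_def)
      show ?thesis by (simp only: eq measure_completion cbox_borel sets_lborel content_cbox_if_cart emp pr vec_lambda_beta)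
    qed
    then show "?Q ?h" by (rule unimodular[OF lin d])
  next
    fix m n :: 'n assume mn: "m \<noteq> n"
    let ?h = "\<lambda>x::real^'n. \<chi> i. if i = m then x$m + x$n else x$i"
    have lin: "linear ?h"
      by (rule linearI) (auto simp: algebra_simps Finite_Cartesian_Product.vec_eq_iff)
    have d: "\<bar>Determinants.det (matrix ?h)\<bar> = 1"
      unfolding matrix_shear by (subst det_row_operation[OF mn]) simp
    have "measure lebesgue (?h ` cbox a b) = measure lebesgue (cbox a b)" for a b
    proof (cases "cbox a b = {}")
      case False
      \<comment> \<open>The lower corner is moved to the origin because
        \<open>measure_shear_interval\<close> wants a nonnegative \<open>n\<close>-th coordinate
        there.\<close>
      have ab: "cbox a b = (+) a ` cbox 0 (b - a)"
        using cbox_translation[of a 0 "b - a"] by simp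
      have "?h ` cbox a b = (+) (?h a) ` ?h ` cbox 0 (b - a)"
        unfolding ab image_comp by (rule image_cong) (auto simp: linear_add[OF lin])
      moreover have "measure lebesgue (?h ` cbox 0 (b - a)) = measure lebesgue (cbox 0 (b - a))"
        using False by (intro measure_shear_interval mn) (auto simp: ab)
      ultimately show ?thesis by (simp only: ab measure_translation)
    qed simp
    then show "?Q ?h" by (rule unimodular[OF lin d])
  qed
  with assms show ?thesis by blast
qed

subsection \<open>The discrete action\<close>

lemma null_sets_lebesgue_subset:
  fixes N :: "'a::euclidean_space set"
  assumes "N \<in> null_sets lebesgue" "M \<subseteq> N"
  shows "M \<in> null_sets lebesgue"
  using assms negligible_subset by (auto simp: negligible_iff_null_sets[symmetric])

lemma matrix_inv_cancel:
  assumes "invertible A"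
  shows "A ** matrix_inv A = Finite_Cartesian_Product.mat 1" "matrix_inv A ** A = Finite_Cartesian_Product.mat 1"
  using someI_ex[OF assms[unfolded invertible_def]] by (simp_all add: matrix_inv_def)

lemma matrix_powi_0 [simp]: "matrix_powi A 0 = Finite_Cartesian_Product.mat 1"
  by (simp add: matrix_powi_def)

lemma matrix_powi_1 [simp]: "matrix_powi A 1 = A"
  by (simp add: matrix_powi_def)

lemma matrix_powi_Suc:
  assumes "invertible A"
  shows "matrix_powi A (k + 1) = A ** matrix_powi A k"
proof (cases "0 \<le> k")
  case True
  then have "nat (k + 1) = Suc (nat k)" by simp
  with True show ?thesis by (simp add: matrix_powi_def)
next
  case False
  then obtain m where k: "k = - int (Suc m)"
    by (metis add.commute add_0 int_cases plus_1_eq_Suc zle_iff_zadd)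
  have "A ** matrix_powi A k = matrix_pow (matrix_inv A) m"
    by (simp add: k matrix_powi_def matrix_mul_assoc matrix_inv_cancel[OF assms] del: of_nat_Suc)
  also have "\<dots> = matrix_powi A (k + 1)"
    by (cases m) (simp_all add: k matrix_powi_def nat_add_distrib)
  finally show ?thesis by simp
qed

lemma matrix_powi_add:
  assumes "invertible A"
  shows "matrix_powi A (j + k) = matrix_powi A j ** matrix_powi A k"
proof (induction j rule: int_induct[where k = 0])
  case base
  then show ?case by simp
next
  case (step1 i)
  then show ?case
    using matrix_powi_Suc[OF assms, of "i + k"] matrix_powi_Suc[OF assms, of i]
    by (simp add: matrix_mul_assoc add_ac)
next
  case (step2 i)
  have "A ** matrix_powi A (i - 1 + k) = matrix_powi A (i + k)"
    using matrix_powi_Suc[OF assms, of "i - 1 + k"] by simp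
  also have "\<dots> = A ** (matrix_powi A (i - 1) ** matrix_powi A k)"
    using step2 matrix_powi_Suc[OF assms, of "i - 1"] by (simp add: matrix_mul_assoc)
  finally have "matrix_inv A ** A ** matrix_powi A (i - 1 + k)
      = matrix_inv A ** A ** (matrix_powi A (i - 1) ** matrix_powi A k)"
    by (metis matrix_mul_assoc)
  then show ?case by (simp add: matrix_inv_cancel[OF assms])
qed

definition act :: "real^'n^'n \<Rightarrow> int \<Rightarrow> real^'n \<Rightarrow> real^'n" where
  "act A k x = x v* matrix_powi A k"

lemma act_0 [simp]: "act A 0 x = x"
  by (simp add: act_def)

lemma act_1: "act A 1 x = x v* A"
  by (simp add: act_def)

lemma act_act:
  assumes "invertible A"
  shows "act A j (act A k x) = act A (j + k) x"
  by (simp add: act_def vector_matrix_mul_assoc add.commute[of j] matrix_powi_add[OF assms])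

lemma act_Suc:
  assumes "invertible A"
  shows "act A (k + 1) x = act A k x v* A"
  using act_act[OF assms, of 1 k x] by (simp add: act_1 add.commute)

lemma act_scaleR: "act A k (c *\<^sub>R x) = c *\<^sub>R act A k x"
  by (simp add: act_def scaleR_vector_matrix_assoc)

lemma linear_act [simp]: "linear (act A k)"
  by (rule linearI) (simp_all add: act_def vector_matrix_left_distrib scaleR_vector_matrix_assoc)

lemma borel_measurable_act [measurable]: "act A k \<in> borel_measurable borel"
  by (intro borel_measurable_continuous_onI linear_continuous_on linear_conv_bounded_linear[THEN iffD1] linear_act)

lemma translate_eq: "translate S A k = act A k ` S"
  by (simp add: translate_def act_def)

lemma mem_translate:
  assumes "invertible A"
  shows "x \<in> translate S A k \<longleftrightarrow> act A (- k) x \<in> S"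
proof
  assume "x \<in> translate S A k"
  then show "act A (- k) x \<in> S" by (auto simp: translate_eq act_act[OF assms])
next
  assume "act A (- k) x \<in> S"
  moreover have "x = act A k (act A (- k) x)" by (simp add: act_act[OF assms])
  ultimately show "x \<in> translate S A k" unfolding translate_eq by (rule rev_image_eqI)
qed

lemma translate_vimage:
  assumes "invertible A"
  shows "translate S A k = act A (- k) -` S"
  using mem_translate[OF assms] by blast

lemma translate_borel [measurable]:
  assumes "invertible A" and [measurable]: "S \<in> sets borel"
  shows "translate S A k \<in> sets borel"
  using measurable_sets[OF borel_measurable_act assms(2), of A "- k"]
  by (simp add: translate_vimage[OF assms(1)])

text \<open>\<open>matrix\<close> represents a map as acting on columns, whence the transpose; the
  determinant does not notice it.\<close>

lemma matrix_act: "matrix (act A k) = transpose (matrix_powi A k)"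
  by (metis (no_types) act_def ext matrix_of_matrix_vector_mul transpose_matrix_vector)

lemma det_matrix_powi:
  assumes "invertible A"
  shows "\<bar>Determinants.det (matrix_powi A k)\<bar> = \<bar>Determinants.det A\<bar> powi k"
proof -
  have nz: "Determinants.det A \<noteq> 0" using assms invertible_det_nz by blast
  show ?thesis
  proof (induction k rule: int_induct[where k = 0])
    case base
    then show ?case by simp
  next
    case (step1 i)
    then show ?case using nz by (simp add: matrix_powi_Suc[OF assms] det_mul abs_mult power_int_add)
  next
    case (step2 i)
    have "\<bar>Determinants.det A\<bar> * \<bar>Determinants.det (matrix_powi A (i - 1))\<bar> = \<bar>Determinants.det A\<bar> powi i"
      using step2 matrix_powi_Suc[OF assms, of "i - 1"] by (simp add: det_mul abs_mult)
    then show ?case using nz by (simp add: power_int_diff field_simps)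
  qed
qed

lemma emeasure_act_image:
  assumes "invertible A" "S \<in> sets borel" "emeasure lebesgue S < \<infinity>"
  shows "emeasure lebesgue (act A k ` S) = ennreal (\<bar>Determinants.det A\<bar> powi k) * emeasure lebesgue S"
proof -
  have S: "S \<in> lmeasurable"
    using assms by (intro fmeasurableI) auto
  have *: "act A k ` S \<in> lmeasurable"
    using measure_linear_image_cart[OF linear_act S] by blast
  have "measure lebesgue (act A k ` S) = \<bar>Determinants.det A\<bar> powi k * measure lebesgue S"
    by (simp add: measure_linear_image_cart[OF linear_act S] matrix_act det_matrix_powi[OF assms(1)])
  then show ?thesis
    using S * by (simp add: emeasure_eq_measure2 ennreal_mult)
qed

text \<open>The equation determines \<open>N\<close> as the complement of the union of the
  translates, so the existential quantifier disappears; and two translates that meet can be moved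
  back until one of them is \<open>S\<close>. This orbitwise form is the one used from here on:
  almost every orbit meets \<open>S\<close>, and none returns to it.\<close>

lemma cross_section_iff:
  assumes "invertible A" "S \<in> sets borel"
  shows "cross_section A S \<longleftrightarrow>
    {x. \<forall>k. act A k x \<notin> S} \<in> null_sets lebesgue \<and> (\<forall>x\<in>S. \<forall>k. act A k x \<in> S \<longrightarrow> k = 0)"
proof -
  have "(\<Union>k. translate S A k) = UNIV - {x. \<forall>k. act A k x \<notin> S}"
    using assms by (auto simp: mem_translate) (metis minus_minus)+
  then have 1: "(\<exists>N \<in> null_sets lebesgue. (\<Union>k. translate S A k) = UNIV - N)
      \<longleftrightarrow> {x. \<forall>k. act A k x \<notin> S} \<in> null_sets lebesgue"
    by (metis Diff_Diff_Int Int_UNIV_left)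
  have 2: "(\<forall>j k. j \<noteq> k \<longrightarrow> translate S A j \<inter> translate S A k = {})
      \<longleftrightarrow> (\<forall>x\<in>S. \<forall>k. act A k x \<in> S \<longrightarrow> k = 0)" (is "?L \<longleftrightarrow> ?R")
  proof
    assume L: ?L
    show ?R
    proof (intro ballI allI impI)
      fix x k assume "x \<in> S" "act A k x \<in> S"
      then have "x \<in> translate S A 0 \<inter> translate S A (- k)"
        by (simp add: mem_translate[OF assms(1)])
      with L show "k = 0" by (metis empty_iff neg_equal_0_iff_equal)
    qed
  next
    assume R: ?R
    show ?L
    proof (intro allI impI, rule ccontr)
      fix j k :: int assume "j \<noteq> k" "translate S A j \<inter> translate S A k \<noteq> {}"
      then obtain x where "act A (- j) x \<in> S" "act A (- k) x \<in> S"
        by (auto simp: mem_translate[OF assms(1)])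
      moreover have "act A (- k) x = act A (j - k) (act A (- j) x)"
        by (simp add: act_act[OF assms(1)])
      ultimately have "j - k = 0" using R by metis
      with \<open>j \<noteq> k\<close> show False by simp
    qed
  qed
  show ?thesis unfolding cross_section_def 1 2 using assms(2) by blast
qed

lemma cross_sectionD:
  assumes "invertible A" "cross_section A S"
  shows "S \<in> sets borel" "{x. \<forall>k. act A k x \<notin> S} \<in> null_sets lebesgue"
    "\<And>x k. x \<in> S \<Longrightarrow> act A k x \<in> S \<Longrightarrow> k = 0"
proof -
  show S: "S \<in> sets borel" using assms(2) by (simp add: cross_section_def)
  show "{x. \<forall>k. act A k x \<notin> S} \<in> null_sets lebesgue"
    "\<And>x k. x \<in> S \<Longrightarrow> act A k x \<in> S \<Longrightarrow> k = 0"
    using assms(2) cross_section_iff[OF assms(1) S] by blast+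
qed

subsection \<open>Constructing cross-sections\<close>

text \<open>Along an orbit in \<open>G\<close> the values of \<open>\<phi>\<close> are
  \<open>\<phi> x + k\<close> for all integers \<open>k\<close>, and exactly one of these lies in
  [0, 1), namely for \<open>k = - \<lfloor>\<phi> x\<rfloor>\<close>.\<close>

lemma cross_section_of_cocycle:
  fixes \<phi> :: "real^'n \<Rightarrow> real"
  assumes A: "invertible A"
    and [measurable]: "G \<in> sets borel" "\<phi> \<in> borel_measurable borel"
    and null: "- G \<in> null_sets lebesgue"
    and inv: "\<And>x. x v* A \<in> G \<longleftrightarrow> x \<in> G"
    and shift: "\<And>x. x \<in> G \<Longrightarrow> \<phi> (x v* A) = \<phi> x + 1"
  shows "cross_section A {x\<in>G. 0 \<le> \<phi> x \<and> \<phi> x < 1}"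
proof -
  note step = act_Suc[OF A]
  have *: "(act A k x \<in> G \<longleftrightarrow> x \<in> G) \<and> (x \<in> G \<longrightarrow> \<phi> (act A k x) = \<phi> x + k)" for k x
  proof (induction k rule: int_induct[where k = 0])
    case base
    then show ?case by simp
  next
    case (step1 i)
    then show ?case by (auto simp: step inv shift)
  next
    case (step2 i)
    have "act A i x = act A (i - 1) x v* A" using step[of "i - 1" x] by simp
    then show ?case using step2 inv shift[of "act A (i - 1) x"] by auto
  qed
  let ?S = "{x\<in>G. 0 \<le> \<phi> x \<and> \<phi> x < 1}"
  have S: "?S \<in> sets borel" by measurable
  have "{x. \<forall>k. act A k x \<notin> ?S} \<subseteq> - G"
  proof
    fix x assume x: "x \<in> {x. \<forall>k. act A k x \<notin> ?S}"
    have "x \<in> G \<Longrightarrow> act A (- \<lfloor>\<phi> x\<rfloor>) x \<in> ?S"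
      using *[of "- \<lfloor>\<phi> x\<rfloor>" x] by auto linarith+
    with x show "x \<in> - G" by blast
  qed
  then have "{x. \<forall>k. act A k x \<notin> ?S} \<in> null_sets lebesgue"
    by (rule null_sets_lebesgue_subset[OF null])
  moreover have "k = 0" if "x \<in> ?S" "act A k x \<in> ?S" for x k
    using that *[of k x] by auto
  ultimately show ?thesis
    using cross_section_iff[OF A S] by blast
qed

text \<open>Points move only within their own orbits, so an orbit that meets \<open>S\<close> once
  meets the image once. The image is Borel since it is a countable union of translates of the pieces
  on which \<open>\<kappa>\<close> is constant.\<close>

lemma cross_section_move:
  fixes A :: "real^'n^'n"
  assumes A: "invertible A" and S: "cross_section A S"
    and [measurable]: "\<kappa> \<in> borel \<rightarrow>\<^sub>M count_space (UNIV :: int set)"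
  shows "cross_section A ((\<lambda>x. act A (\<kappa> x) x) ` S)" (is "cross_section A ?T")
proof -
  note S' [measurable] = cross_sectionD[OF A S]
  have "?T = (\<Union>k. translate {x\<in>S. \<kappa> x = k} A k)"
    by (auto simp: translate_eq)
  also have "\<dots> \<in> sets borel"
    by (intro sets.countable_UN'' translate_borel[OF A]) auto
  finally have T: "?T \<in> sets borel" .
  have "{x. \<forall>k. act A k x \<notin> ?T} \<subseteq> {x. \<forall>k. act A k x \<notin> S}"
  proof clarify
    fix x k assume x: "\<forall>k. act A k x \<notin> ?T" and "act A k x \<in> S"
    then have "act A (\<kappa> (act A k x) + k) x \<in> ?T"
      by (auto intro!: image_eqI[of _ _ "act A k x"] simp: act_act[OF A])
    with x show False by blast
  qed
  then have "{x. \<forall>k. act A k x \<notin> ?T} \<in> null_sets lebesgue"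
    by (rule null_sets_lebesgue_subset[OF S'(2)])
  moreover have "k = 0" if "x \<in> ?T" "act A k x \<in> ?T" for x k
  proof -
    from that obtain y z where y: "y \<in> S" "x = act A (\<kappa> y) y"
      and z: "z \<in> S" "act A k x = act A (\<kappa> z) z" by blast
    have "act A (- \<kappa> z) (act A k x) = z"
      by (simp only: z(2) act_act[OF A]) simp
    then have eq: "act A (k + \<kappa> y - \<kappa> z) y = z"
      by (simp add: y(2) act_act[OF A])
    \<comment> \<open>\<open>y\<close> and \<open>z\<close> are points of \<open>S\<close> on one
      orbit, hence the same point with the same displacement.\<close>
    have m: "k + \<kappa> y - \<kappa> z = 0" by (intro S'(3)[OF y(1)]) (simp only: eq z(1))
    then have "y = z" using eq by simp
    with m show "k = 0" by simp
  qed
  ultimately show ?thesis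
    using cross_section_iff[OF A T] by blast
qed

subsection \<open>The measure of a cross-section\<close>

text \<open>The translates of \<open>S\<close> tile the space up to the null set of orbits that miss
  \<open>S\<close>.\<close>

lemma emeasure_cross_section_decomp:
  assumes A: "invertible A" and S: "cross_section A S" and B: "B \<in> sets borel"
  shows "emeasure lebesgue B = (\<integral>\<^sup>+k. emeasure lebesgue (B \<inter> translate S A k) \<partial>count_space UNIV)"
proof -
  note S' = cross_sectionD[OF A S]
  let ?N = "{x. \<forall>k. act A k x \<notin> S}"
  have tr [measurable]: "translate S A k \<in> sets borel" for k
    by (rule translate_borel[OF A S'(1)])
  have m: "B \<inter> translate S A k \<in> sets lebesgue" for k
    using B tr[of k] by auto
  have "emeasure lebesgue B = emeasure lebesgue (B - ?N)"
    using B S'(2) by (subst emeasure_Diff_null_set) auto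
  also have "B - ?N = (\<Union>k. B \<inter> translate S A k)"
    by (auto simp: mem_translate[OF A]) (metis minus_minus)
  also have "emeasure lebesgue \<dots> = (\<integral>\<^sup>+k. emeasure lebesgue (B \<inter> translate S A k) \<partial>count_space UNIV)"
  proof (intro emeasure_UN_countable)
    show "disjoint_family_on (\<lambda>k. B \<inter> translate S A k) UNIV"
      using S by (auto simp: disjoint_family_on_def cross_section_def)
  qed (use m in auto)
  finally show ?thesis .
qed

lemma emeasure_cross_section_pos:
  assumes A: "invertible A" and S: "cross_section A S"
  shows "emeasure lebesgue S \<noteq> 0"
proof
  assume 0: "emeasure lebesgue S = 0"
  have "emeasure lebesgue (translate S A k) = 0" for k
    using emeasure_act_image[OF A cross_sectionD(1)[OF A S], of k] 0 by (simp add: translate_eq)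
  then have "emeasure lebesgue (UNIV \<inter> translate S A k) = 0" for k by simp
  then have "emeasure lebesgue (UNIV :: (real^'a) set) = 0"
    by (subst emeasure_cross_section_decomp[OF A S]) simp_all
  then show False by simp
qed

text \<open>An exchange of pieces: the part of \<open>S\<close> in the \<open>k\<close>-th translate
  of \<open>T\<close> is carried by the \<open>-k\<close>-th power of \<open>A\<close>, which
  preserves measure, onto the part of \<open>T\<close> in the \<open>-k\<close>-th translate of
  \<open>S\<close>. Summing over \<open>k\<close> rebuilds \<open>S\<close> on one side and
  \<open>T\<close> on the other.\<close>

lemma emeasure_cross_section_eq:
  assumes A: "invertible A" and det: "\<bar>Determinants.det A\<bar> = 1"
    and S: "cross_section A S" and fS: "emeasure lebesgue S < \<infinity>"
    and T: "cross_section A T"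
  shows "emeasure lebesgue S = emeasure lebesgue T"
proof -
  note [measurable] = cross_sectionD(1)[OF A S] cross_sectionD(1)[OF A T]
  have eq: "emeasure lebesgue (S \<inter> translate T A k) = emeasure lebesgue (T \<inter> translate S A (- k))" for k
  proof -
    have "translate (S \<inter> translate T A k) A (- k) = T \<inter> translate S A (- k)"
      by (auto simp: mem_translate[OF A] act_act[OF A])
    moreover have "emeasure lebesgue (translate (S \<inter> translate T A k) A (- k))
        = emeasure lebesgue (S \<inter> translate T A k)"
    proof -
      have 1: "S \<inter> translate T A k \<in> sets borel"
        using cross_sectionD(1)[OF A S] translate_borel[OF A cross_sectionD(1)[OF A T], of k] by blast
      have "emeasure lebesgue (S \<inter> translate T A k) \<le> emeasure lebesgue S"
        using cross_sectionD(1)[OF A S] by (intro emeasure_mono) auto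
      then have "emeasure lebesgue (S \<inter> translate T A k) < \<infinity>"
        using fS by (rule le_less_trans)
      from emeasure_act_image[OF A 1 this] show ?thesis by (simp add: translate_eq det)
    qed
    ultimately show ?thesis by simp
  qed
  have "emeasure lebesgue S = (\<integral>\<^sup>+k. emeasure lebesgue (S \<inter> translate T A k) \<partial>count_space UNIV)"
    by (rule emeasure_cross_section_decomp[OF A T]) measurable
  also have "\<dots> = (\<integral>\<^sup>+k. emeasure lebesgue (T \<inter> translate S A (- k)) \<partial>count_space UNIV)"
    by (simp only: eq)
  also have "\<dots> = (\<integral>\<^sup>+k. emeasure lebesgue (T \<inter> translate S A k) \<partial>count_space UNIV)"
    by (rule nn_integral_bij_count_space) (rule bij_uminus)
  also have "\<dots> = emeasure lebesgue T"
    by (rule emeasure_cross_section_decomp[OF A S, symmetric]) measurable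
  finally show ?thesis .
qed

lemma cross_section_scaleR:
  assumes A: "invertible A" and S: "cross_section A S" and c: "c \<noteq> 0"
  shows "cross_section A ((*\<^sub>R) c ` S)"
proof -
  note S' = cross_sectionD[OF A S]
  have iff: "x \<in> (*\<^sub>R) c ` T \<longleftrightarrow> inverse c *\<^sub>R x \<in> T" for x and T :: "(real^'a) set"
    using c by (metis (no_types, lifting) image_iff scaleR_left_imp_eq scaleR_scaleR right_inverse scaleR_one)
  have "(*\<^sub>R) c ` S = (*\<^sub>R) (inverse c) -` S \<inter> space borel"
    by (simp add: set_eq_iff iff)
  also have "\<dots> \<in> sets borel"
    using S'(1) by measurable
  finally have b: "(*\<^sub>R) c ` S \<in> sets borel" .
  \<comment> \<open>The summand 0 puts the dilation into the form expected by
    \<open>emeasure_lebesgue_affine\<close>.\<close>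
  have "{x. \<forall>k. act A k x \<notin> (*\<^sub>R) c ` S} = (\<lambda>x. c *\<^sub>R x + 0) ` {x. \<forall>k. act A k x \<notin> S}"
    by (simp add: set_eq_iff iff act_scaleR[symmetric])
  then have "emeasure lebesgue {x. \<forall>k. act A k x \<notin> (*\<^sub>R) c ` S}
      = ennreal (\<bar>c\<bar> ^ CARD('a)) * emeasure lebesgue {x. \<forall>k. act A k x \<notin> S}"
    by (simp only: emeasure_lebesgue_affine) (simp add: ennreal_power)
  also have "\<dots> = 0" using S'(2) by (simp add: null_sets_def)
  finally have "emeasure lebesgue {x. \<forall>k. act A k x \<notin> (*\<^sub>R) c ` S} = 0" .
  moreover have "{x. \<forall>k. act A k x \<notin> (*\<^sub>R) c ` S} \<in> sets borel"
    using b by measurable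
  ultimately have "{x. \<forall>k. act A k x \<notin> (*\<^sub>R) c ` S} \<in> null_sets lebesgue"
    by (auto simp: null_sets_def)
  then show ?thesis
    using S'(3) by (auto simp: cross_section_iff[OF A b] iff act_scaleR[symmetric])
qed

lemma infinite_cross_section:
  assumes A: "invertible A" and det: "\<bar>Determinants.det A\<bar> = 1" and S: "cross_section A S"
  shows "emeasure lebesgue S = \<infinity>"
proof (rule ccontr)
  assume "emeasure lebesgue S \<noteq> \<infinity>"
  then have fin: "emeasure lebesgue S < \<infinity>" by (simp add: top.not_eq_extremum)
  have "emeasure lebesgue S = emeasure lebesgue ((\<lambda>x. 2 *\<^sub>R x + 0) ` S)"
    using emeasure_cross_section_eq[OF A det S fin cross_section_scaleR[OF A S, of 2]] by simp
  also have "\<dots> = 2 ^ CARD('a) * emeasure lebesgue S"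
    by (subst emeasure_lebesgue_affine) (simp add: ennreal_power[symmetric])
  finally have "emeasure lebesgue S = 2 ^ CARD('a) * emeasure lebesgue S" .
  moreover obtain s where s: "emeasure lebesgue S = ennreal s" "s \<ge> 0"
    using fin by (cases "emeasure lebesgue S") auto
  ultimately have "ennreal s = ennreal (2 ^ CARD('a) * s)"
    by (simp add: ennreal_mult ennreal_power[symmetric])
  then have "s = 2 ^ CARD('a) * s" using s by (subst (asm) ennreal_inj) auto
  moreover have "(2::real) ^ CARD('a) > 1" by (simp add: one_less_power)
  ultimately have "s = 0" by simp
  then show False using s emeasure_cross_section_pos[OF A S] by simp
qed

lemma orthogonal_no_cross_section:
  fixes A :: "real^'n^'n"
  assumes A: "invertible A" and orth: "orthogonal_matrix A"
  shows "\<not> cross_section A S"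
proof
  assume S: "cross_section A S"
  have det: "\<bar>Determinants.det A\<bar> = 1" using det_orthogonal_matrix[OF orth] by auto
  let ?B = "ball 0 1 :: (real^'n) set"
  have "norm (x v* A) = norm x" for x
    using orth orthogonal_transformation_norm[of "(*v) (transpose A)" x]
    by (simp add: orthogonal_transformation_matrix orthogonal_matrix_transpose)
  then have step: "norm (act A (k + 1) x) = norm (act A k x)" for k x
    by (simp add: act_Suc[OF A])
  have norm: "norm (act A k x) = norm x" for k x
  proof (induction k rule: int_induct[where k = 0])
    case (step2 i)
    then show ?case using step[of "i - 1" x] by simp
  qed (simp_all add: step)
  have eq: "?B \<inter> translate S A k = act A k ` (S \<inter> ?B)" for k
    by (auto simp: translate_eq norm)
  have b: "S \<inter> ?B \<in> sets borel" using cross_sectionD(1)[OF A S] by auto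
  have finB: "emeasure lebesgue ?B < \<infinity>"
    using emeasure_lborel_ball_finite[of "0 :: real^'n" 1] by simp
  have "emeasure lebesgue (S \<inter> ?B) \<le> emeasure lebesgue ?B"
    by (intro emeasure_mono) auto
  then have fin: "emeasure lebesgue (S \<inter> ?B) < \<infinity>"
    using finB by (rule le_less_trans)
  have "emeasure lebesgue ?B = (\<integral>\<^sup>+(k::int). emeasure lebesgue (S \<inter> ?B) \<partial>count_space UNIV)"
    by (subst emeasure_cross_section_decomp[OF A S])
       (simp_all only: eq emeasure_act_image[OF A b fin] det power_int_1_left ennreal_1 mult_1 borel_open open_ball)
  also have "\<dots> = emeasure lebesgue (S \<inter> ?B) * \<infinity>"
    by (simp add: emeasure_count_space)
  finally have "emeasure lebesgue ?B = emeasure lebesgue (S \<inter> ?B) * \<infinity>" .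
  \<comment> \<open>A multiple of infinity is 0 or infinite, and the ball has finite
    measure.\<close>
  with finB have "emeasure lebesgue ?B = 0"
    by (cases "emeasure lebesgue (S \<inter> ?B) = 0") (auto simp: ennreal_mult_top)
  then have "negligible ?B" by (simp add: negligible_iff_null_sets null_sets_def)
  then show False using open_not_negligible[of ?B] by simp
qed

lemma finite_cross_section:
  fixes A :: "real^'n^'n"
  assumes A: "invertible A" and det: "\<bar>Determinants.det A\<bar> \<noteq> 1" and S: "cross_section A S"
  shows "\<exists>T. cross_section A T \<and> emeasure lebesgue T < \<infinity>"
proof -
  let ?D = "\<bar>Determinants.det A\<bar>"
  have D: "?D > 0" using A by (simp add: invertible_det_nz)
  \<comment> \<open>Slicing by the integer part of the norm gives bounded pieces, and makes the
    index of its piece a Borel function of the point.\<close>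
  define P where "P i = {x\<in>S. nat \<lfloor>norm x\<rfloor> = i}" for i
  have [measurable]: "S \<in> sets borel" by (rule cross_sectionD[OF A S])
  have P: "P i \<in> sets borel" for i unfolding P_def by measurable
  have fin: "emeasure lebesgue (P i) < \<infinity>" for i
  proof -
    have "P i \<subseteq> ball 0 (real i + 1)"
      unfolding P_def by auto
    then have "emeasure lebesgue (P i) \<le> emeasure lebesgue (ball 0 (real i + 1) :: (real^'n) set)"
      by (intro emeasure_mono) auto
    also have "\<dots> < \<infinity>"
      using emeasure_lborel_ball_finite[of "0 :: real^'n" "real i + 1"] by simp
    finally show ?thesis .
  qed
  have small: "\<exists>k. ?D powi k < e" if "e > 0" for e :: real
  proof (cases "?D < 1")
    case True
    with real_arch_pow_inv[OF that] obtain n where "?D ^ n < e" by blast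
    then show ?thesis by (intro exI[of _ "int n"]) simp
  next
    case False
    with det have "inverse ?D < 1" by (simp add: field_simps)
    with real_arch_pow_inv[OF that] obtain n where "inverse ?D ^ n < e" by blast
    then show ?thesis by (intro exI[of _ "- int n"]) (simp add: power_int_minus power_inverse)
  qed
  have "\<exists>k. emeasure lebesgue (act A k ` P i) \<le> ennreal ((1/2) ^ i)" for i
  proof -
    obtain m where m: "emeasure lebesgue (P i) = ennreal m" "m \<ge> 0"
      using fin[of i] by (cases "emeasure lebesgue (P i)") auto
    \<comment> \<open>Dividing by \<open>m + 1\<close> rather than \<open>m\<close> also covers
      pieces of measure zero.\<close>
    obtain k where k: "?D powi k < (1/2) ^ i / (m + 1)"
      using small[of "(1/2) ^ i / (m + 1)"] m(2) by auto
    have "?D powi k * m \<le> ?D powi k * (m + 1)"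
      using D by (intro mult_left_mono) (auto simp: zero_le_power_int)
    also have "\<dots> \<le> (1/2) ^ i"
      using k m(2) by (simp add: pos_less_divide_eq)
    finally have "ennreal (?D powi k * m) \<le> ennreal ((1/2) ^ i)"
      by (rule ennreal_leI)
    then show ?thesis
      using D m by (intro exI[of _ k]) (simp add: emeasure_act_image[OF A P fin] ennreal_mult zero_le_power_int)
  qed
  then obtain k where k: "\<And>i. emeasure lebesgue (act A (k i) ` P i) \<le> ennreal ((1/2) ^ i)"
    by metis
  let ?T = "(\<lambda>x. act A (k (nat \<lfloor>norm x\<rfloor>)) x) ` S"
  have "?T = (\<Union>i. act A (k i) ` P i)"
    by (auto simp: P_def)
  then have "emeasure lebesgue ?T = emeasure lebesgue (\<Union>i. act A (k i) ` P i)"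
    by simp
  also have "\<dots> \<le> (\<Sum>i. emeasure lebesgue (act A (k i) ` P i))"
    using translate_borel[OF A P] by (intro emeasure_subadditive_countably) (auto simp: translate_eq)
  also have "\<dots> \<le> (\<Sum>i. ennreal ((1/2) ^ i))"
    by (intro suminf_le k) auto
  also have "\<dots> = ennreal 2"
    using geometric_sums[of "1/2 :: real"] by (intro suminf_ennreal_eq) auto
  finally have "emeasure lebesgue ?T < \<infinity>"
    by (rule le_less_trans) simp
  moreover have "cross_section A ?T"
    by (intro cross_section_move[OF A S]) measurable
  ultimately show ?thesis by blast
qed

text \<open>The displacement is the first time at which the orbit, run in the direction of
  \<open>\<sigma>\<close>, enters the closed unit ball; taking the least such time makes the choice
  Borel.\<close>

lemma bounded_cross_section:
  fixes A :: "real^'n^'n"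
  assumes A: "invertible A" and S: "cross_section A S"
    and lim: "\<And>x. (\<lambda>n. act A (\<sigma> * int n) x) \<longlonglongrightarrow> 0"
  shows "\<exists>T. cross_section A T \<and> bounded T"
proof -
  define \<nu> where "\<nu> x = (LEAST n. norm (act A (\<sigma> * int n) x) \<le> 1)" for x
  have [measurable]: "\<nu> \<in> borel \<rightarrow>\<^sub>M count_space UNIV"
    unfolding \<nu>_def by measurable
  have "norm (act A (\<sigma> * int (\<nu> x)) x) \<le> 1" for x
  proof -
    from LIMSEQ_D[OF lim[of x], of 1] obtain n where "norm (act A (\<sigma> * int n) x) < 1" by auto
    then have "norm (act A (\<sigma> * int n) x) \<le> 1" by simp
    then show ?thesis unfolding \<nu>_def by (rule LeastI)
  qed
  then have "bounded ((\<lambda>x. act A (\<sigma> * int (\<nu> x)) x) ` S)"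
    by (auto simp: bounded_iff)
  moreover have "cross_section A ((\<lambda>x. act A (\<sigma> * int (\<nu> x)) x) ` S)"
    by (intro cross_section_move[OF A S]) measurable
  ultimately show ?thesis by blast
qed

subsection \<open>Complex linear functionals\<close>

definition cmat :: "real^'n^'m \<Rightarrow> complex^'n^'m" where
  "cmat A = (\<chi> i j. complex_of_real (A $ i $ j))"

text \<open>The product of a row and a column, without conjugation, so that it is complex linear in
  \<open>v\<close> and A moves from one side to the other as in \<open>cpair_mult\<close>.\<close>

definition cpair :: "real^'n \<Rightarrow> complex^'n \<Rightarrow> complex" where
  "cpair x v = (\<Sum>i\<in>UNIV. complex_of_real (x $ i) * v $ i)"

lemma cpair_mult: "cpair (x v* A) v = cpair x (cmat A *v v)"
proof -
  have "cpair (x v* A) v = (\<Sum>j\<in>UNIV. \<Sum>i\<in>UNIV. complex_of_real (x $ i) * (complex_of_real (A $ i $ j) * v $ j))"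
    by (simp add: cpair_def vector_matrix_mult_def sum_distrib_right sum_distrib_left mult_ac)
  also have "\<dots> = cpair x (cmat A *v v)"
    by (subst sum.swap) (simp add: cpair_def cmat_def matrix_vector_mult_def sum_distrib_left)
  finally show ?thesis .
qed

lemma cpair_add_left: "cpair (x + y) v = cpair x v + cpair y v"
  by (simp add: cpair_def algebra_simps sum.distrib)

lemma cpair_add_right: "cpair x (v + w) = cpair x v + cpair x w"
  by (simp add: cpair_def algebra_simps sum.distrib)

lemma cpair_scaleR: "cpair (r *\<^sub>R x) v = r *\<^sub>R cpair x v"
  by (simp add: cpair_def scaleR_conv_of_real[where 'a = complex] sum_distrib_left mult_ac)

lemma cpair_smult: "cpair x (c *s v) = c * cpair x v"
  by (simp add: cpair_def sum_distrib_left mult_ac)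

lemma cpair_0 [simp]: "cpair x 0 = 0"
  by (simp add: cpair_def)

lemma cpair_axis: "cpair (axis i 1) v = v $ i"
proof -
  have "cpair (axis i 1) v = (\<Sum>j\<in>UNIV. if j = i then v $ j else 0)"
    unfolding cpair_def by (intro sum.cong) (auto simp: axis_def)
  then show ?thesis by simp
qed

lemma bounded_linear_cpair: "bounded_linear (\<lambda>x. cpair x v)"
  by (intro linear_conv_bounded_linear[THEN iffD1] linearI cpair_add_left cpair_scaleR)

lemma borel_measurable_cpair [measurable]: "(\<lambda>x. cpair x v) \<in> borel_measurable borel"
  by (intro borel_measurable_continuous_onI linear_continuous_on bounded_linear_cpair)

text \<open>The real or the imaginary part of \<open>v\<close> is nonzero, and the zero set lies in
  the real hyperplane orthogonal to it.\<close>

lemma null_sets_cpair: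
  assumes "v \<noteq> 0"
  shows "{x. cpair x v = 0} \<in> null_sets lebesgue"
proof -
  let ?re = "\<chi> i. Re (v $ i)" and ?im = "\<chi> i. Im (v $ i)"
  have "?re \<noteq> 0 \<or> ?im \<noteq> 0"
    using assms by (auto simp: Finite_Cartesian_Product.vec_eq_iff complex_eq_iff)
  moreover have "{x. cpair x v = 0} \<subseteq> {x. ?re \<bullet> x = 0}" "{x. cpair x v = 0} \<subseteq> {x. ?im \<bullet> x = 0}"
    by (auto simp: cpair_def complex_eq_iff inner_vec_def mult.commute)
  ultimately show ?thesis
    using negligible_hyperplane[of ?re 0] negligible_hyperplane[of ?im 0] negligible_subset
    unfolding negligible_iff_null_sets[symmetric] by metis
qed

text \<open>Every \<open>x\<close> has the form \<open>y v* A\<close>, so a zero eigenvalue would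
  make all pairings with \<open>v\<close> vanish, in particular the coordinates of
  \<open>v\<close>.\<close>

lemma eigenvalue_nonzero:
  assumes A: "invertible A" and v: "v \<noteq> 0" "cmat A *v v = \<mu> *s v"
  shows "\<mu> \<noteq> 0"
proof
  assume "\<mu> = 0"
  have "cpair x v = 0" for x
  proof -
    have "x = (x v* matrix_inv A) v* A"
      by (simp add: vector_matrix_mul_assoc matrix_inv_cancel[OF A])
    then have "cpair x v = cpair (x v* matrix_inv A) (cmat A *v v)"
      by (metis cpair_mult)
    then show ?thesis by (simp add: v(2) cpair_smult \<open>\<mu> = 0\<close>)
  qed
  then have "v $ i = 0" for i using cpair_axis by metis
  then show False using v(1) by (simp add: Finite_Cartesian_Product.vec_eq_iff)
qed

lemma cross_section_of_eigenvector:
  fixes A :: "real^'n^'n"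
  assumes A: "invertible A" and v: "v \<noteq> 0" "cmat A *v v = \<mu> *s v" and \<mu>: "cmod \<mu> \<noteq> 1"
  shows "\<exists>S. cross_section A S"
proof -
  have nz: "\<mu> \<noteq> 0" by (rule eigenvalue_nonzero[OF A v])
  have ln: "ln (cmod \<mu>) \<noteq> 0" using nz \<mu> by simp
  let ?G = "{x. cpair x v \<noteq> 0}"
  \<comment> \<open>The logarithm to base \<open>cmod \<mu>\<close>, which grows by exactly 1 per
    step whichever side of 1 the base lies on.\<close>
  let ?\<phi> = "\<lambda>x. ln (cmod (cpair x v)) / ln (cmod \<mu>)"
  have step: "cpair (x v* A) v = \<mu> * cpair x v" for x
    by (simp add: cpair_mult v(2) cpair_smult)
  have "- ?G = {x. cpair x v = 0}" by auto
  then have null: "- ?G \<in> null_sets lebesgue" using null_sets_cpair[OF v(1)] by simp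
  have "cross_section A {x\<in>?G. 0 \<le> ?\<phi> x \<and> ?\<phi> x < 1}"
  proof (rule cross_section_of_cocycle[OF A _ _ null])
    show "?G \<in> sets borel" "?\<phi> \<in> borel_measurable borel" by measurable
    show "x v* A \<in> ?G \<longleftrightarrow> x \<in> ?G" for x by (simp add: step nz)
    show "?\<phi> (x v* A) = ?\<phi> x + 1" if "x \<in> ?G" for x
      using that nz ln by (simp add: step norm_mult ln_mult add_divide_distrib)
  qed
  then show ?thesis by blast
qed

text \<open>The quotient of the pairings with \<open>w\<close> and \<open>v\<close> grows by
  \<open>1 / \<mu>\<close> at each step, since the common factor \<open>\<mu>\<close> cancels. The
  extra factor \<open>\<mu>\<close> in \<open>?\<phi>\<close> normalises this increment to 1, which
  the real part preserves.\<close>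

lemma cross_section_of_generalized_eigenvector:
  fixes A :: "real^'n^'n"
  assumes A: "invertible A" and v: "v \<noteq> 0" "cmat A *v v = \<mu> *s v" and w: "cmat A *v w = \<mu> *s w + v"
  shows "\<exists>S. cross_section A S"
proof -
  have nz: "\<mu> \<noteq> 0" by (rule eigenvalue_nonzero[OF A v])
  let ?G = "{x. cpair x v \<noteq> 0}"
  let ?\<phi> = "\<lambda>x. Re (\<mu> * cpair x w / cpair x v)"
  have step: "cpair (x v* A) v = \<mu> * cpair x v" "cpair (x v* A) w = \<mu> * cpair x w + cpair x v" for x
    by (simp_all add: cpair_mult v(2) w cpair_smult cpair_add_right)
  have "- ?G = {x. cpair x v = 0}" by auto
  then have null: "- ?G \<in> null_sets lebesgue" using null_sets_cpair[OF v(1)] by simp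
  have "cross_section A {x\<in>?G. 0 \<le> ?\<phi> x \<and> ?\<phi> x < 1}"
  proof (rule cross_section_of_cocycle[OF A _ _ null])
    show "?G \<in> sets borel" "?\<phi> \<in> borel_measurable borel" by measurable
    show "x v* A \<in> ?G \<longleftrightarrow> x \<in> ?G" for x by (simp add: step nz)
    show "?\<phi> (x v* A) = ?\<phi> x + 1" if "x \<in> ?G" for x
    proof -
      have "\<mu> * cpair (x v* A) w / cpair (x v* A) v = \<mu> * cpair x w / cpair x v + 1"
        using that nz by (simp add: step field_simps)
      then show ?thesis by simp
    qed
  qed
  then show ?thesis by blast
qed

text \<open>With \<open>f(x) = |x v|\<close>, which is bounded on \<open>S\<close>: if the conclusion failed, the open set \<open>{f > C}\<close>
  would be covered by half an orbit of \<open>S\<close>, whose measure is a convergent geometric series; but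
  it is mapped into itself by doubling, so its measure is infinite.\<close>

lemma bounded_cross_section_eigenvalue:
  fixes A :: "real^'n^'n"
  assumes A: "invertible A" and S: "cross_section A S" and bdd: "bounded S"
    and v: "v \<noteq> 0" "cmat A *v v = \<mu> *s v"
    and \<sigma>: "\<sigma> = 1 \<or> \<sigma> = -1" and det: "\<bar>Determinants.det A\<bar> powi \<sigma> < 1"
  shows "cmod \<mu> powi \<sigma> < 1"
proof (rule ccontr)
  assume "\<not> cmod \<mu> powi \<sigma> < 1"
  then have big: "cmod \<mu> powi \<sigma> \<ge> 1" by simp
  let ?f = "\<lambda>x. cmod (cpair x v)"
  have nz: "\<mu> \<noteq> 0" by (rule eigenvalue_nonzero[OF A v])
  define r where "r = \<bar>Determinants.det A\<bar> powi \<sigma>"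
  have r: "0 \<le> r" "r < 1" using det by (auto simp: r_def zero_le_power_int)
  note S' = cross_sectionD[OF A S]
  obtain C where C: "\<And>x. x \<in> S \<Longrightarrow> ?f x \<le> C"
    using bounded_linear_image[OF bdd bounded_linear_cpair[of v]] by (auto simp: bounded_iff)
  have step: "?f (act A (i + 1) x) = cmod \<mu> * ?f (act A i x)" for i x
    by (simp add: act_Suc[OF A] cpair_mult v(2) cpair_smult norm_mult)
  have f_act: "?f (act A i x) = cmod \<mu> powi i * ?f x" for i x
  proof (induction i rule: int_induct[where k = 0])
    case base
    then show ?case by simp
  next
    case (step1 i)
    then show ?case using nz by (simp add: step power_int_add)
  next
    case (step2 i)
    then show ?case using nz step[of "i - 1" x] by (simp add: power_int_diff field_simps)
  qed
  \<comment> \<open>A nonnegative threshold makes \<open>?f\<close> positive on \<open>U\<close>, so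
    doubling maps \<open>U\<close> into itself.\<close>
  define U where "U = {x. max C 0 < ?f x}"
  have sub: "U \<subseteq> {x. \<forall>k. act A k x \<notin> S} \<union> (\<Union>n. act A (\<sigma> * int n) ` S)"
  proof
    fix x assume x: "x \<in> U"
    show "x \<in> {x. \<forall>k. act A k x \<notin> S} \<union> (\<Union>n. act A (\<sigma> * int n) ` S)"
    proof (cases "\<exists>k. act A k x \<in> S")
      case True
      then obtain k where k: "act A k x \<in> S" by blast
      \<comment> \<open>Moving in the direction of \<open>\<sigma>\<close> does not decrease
        \<open>?f\<close>, so a point where \<open>?f\<close> exceeds \<open>C\<close> cannot reach
        \<open>S\<close> that way.\<close>
      have "\<sigma> * k \<le> 0"
      proof (rule ccontr)
        assume "\<not> \<sigma> * k \<le> 0"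
        then have "k = \<sigma> * int (nat (\<sigma> * k))" using \<sigma> by auto
        then have "cmod \<mu> powi k = (cmod \<mu> powi \<sigma>) ^ nat (\<sigma> * k)"
          by (metis power_int_mult power_int_of_nat)
        also have "\<dots> \<ge> 1" using big by simp
        finally have "?f x \<le> ?f (act A k x)"
          by (simp add: f_act mult_le_cancel_right1)
        also have "\<dots> \<le> C" by (rule C[OF k])
        finally show False using x by (simp add: U_def)
      qed
      then have "- k = \<sigma> * int (nat (- \<sigma> * k))" using \<sigma> by auto
      then have "x = act A (\<sigma> * int (nat (- \<sigma> * k))) (act A k x)"
        by (metis act_0 act_act[OF A] add.left_inverse)
      with k show ?thesis by blast
    qed simp
  qed
  have bo: "act A k ` S \<in> sets lebesgue" for k
    using translate_borel[OF A S'(1), of k] by (simp add: translate_eq)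
  have finS: "emeasure lebesgue S < \<infinity>"
    using emeasure_bounded_finite[OF bdd] S'(1) by simp
  have U: "open U"
    unfolding U_def
    by (intro open_Collect_less continuous_intros linear_continuous_on bounded_linear_cpair)
  have "emeasure lebesgue U \<le> emeasure lebesgue ({x. \<forall>k. act A k x \<notin> S} \<union> (\<Union>n. act A (\<sigma> * int n) ` S))"
    using S'(2) bo by (intro emeasure_mono sub sets.Un sets.countable_UN) auto
  also have "\<dots> = emeasure lebesgue (\<Union>n. act A (\<sigma> * int n) ` S)"
    using S'(2) bo by (subst Un_commute, intro emeasure_Un_null_set sets.countable_UN) auto
  also have "\<dots> \<le> (\<Sum>n. emeasure lebesgue (act A (\<sigma> * int n) ` S))"
    using bo by (intro emeasure_subadditive_countably) auto
  also have "\<dots> = (\<Sum>n. ennreal (r ^ n) * emeasure lebesgue S)"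
    by (simp add: emeasure_act_image[OF A S'(1) finS] r_def power_int_mult)
  also have "\<dots> = ennreal (1 / (1 - r)) * emeasure lebesgue S"
    using r geometric_sums[of r] by (subst ennreal_suminf_multc, subst suminf_ennreal_eq) auto
  also have "\<dots> < \<infinity>"
    using finS by (simp add: ennreal_mult_less_top)
  finally have fin: "emeasure lebesgue U < \<infinity>" .
  have "(\<lambda>x. 2 *\<^sub>R x + 0) ` U \<subseteq> U"
    by (auto simp: U_def cpair_scaleR) (smt (verit) norm_ge_zero)
  then have "emeasure lebesgue ((\<lambda>x. 2 *\<^sub>R x + 0) ` U) \<le> emeasure lebesgue U"
    using U by (intro emeasure_mono) auto
  then have le: "2 ^ CARD('n) * emeasure lebesgue U \<le> emeasure lebesgue U"
    by (subst (asm) emeasure_lebesgue_affine) (simp add: ennreal_power[symmetric])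
  obtain s where s: "emeasure lebesgue U = ennreal s" "s \<ge> 0"
    using fin by (cases "emeasure lebesgue U") auto
  have "ennreal (2 ^ CARD('n) * s) \<le> ennreal s"
    using le s by (simp add: ennreal_mult ennreal_power[symmetric])
  then have "2 ^ CARD('n) * s \<le> s" using s by (subst (asm) ennreal_le_iff) auto
  moreover have "1 * s < 2 ^ CARD('n) * s" if "s \<noteq> 0"
    using that s(2) by (intro mult_strict_right_mono one_less_power) auto
  ultimately have "s = 0" by force
  then have "negligible U" using U s by (simp add: negligible_iff_null_sets null_sets_def)
  then have "U = {}" using open_not_negligible[OF U] by blast
  moreover obtain i where i: "v $ i \<noteq> 0"
    using v(1) by (auto simp: Finite_Cartesian_Product.vec_eq_iff)
  \<comment> \<open>A multiple of a basis vector on which \<open>?f\<close> equals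
    \<open>max C 0 + 1\<close>.\<close>
  then have "((max C 0 + 1) / cmod (v $ i)) *\<^sub>R axis i 1 \<in> U"
    by (auto simp: U_def cpair_scaleR cpair_axis max_def)
  ultimately show False by blast
qed

subsection \<open>Jordan chains\<close>

text \<open>Numbered upwards from the eigenvector, so that an induction on the index climbs the
  chain; a positive length guarantees that the eigenvector belongs to it.\<close>

definition jordan_chain :: "real^'n^'n \<Rightarrow> complex \<Rightarrow> nat \<Rightarrow> (nat \<Rightarrow> complex^'n) \<Rightarrow> bool" where
  "jordan_chain A \<mu> m w \<longleftrightarrow> 0 < m \<and> w 0 \<noteq> 0 \<and> cmat A *v w 0 = \<mu> *s w 0 \<and>
     (\<forall>j. Suc j < m \<longrightarrow> cmat A *v w (Suc j) = \<mu> *s w (Suc j) + w j)"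

text \<open>Once the perturbation stays below \<open>e / 2 * (1 - cmod \<mu>)\<close>, the bound
  \<open>e / 2\<close> is the fixed point of the recursion on norms, and the initial excess over it
  decays geometrically.\<close>

lemma perturbed_contraction_tendsto_0:
  fixes x y :: "nat \<Rightarrow> complex"
  assumes \<mu>: "cmod \<mu> < 1" and x: "\<And>k. x (Suc k) = \<mu> * x k + y k" and y: "y \<longlonglongrightarrow> 0"
  shows "x \<longlonglongrightarrow> 0"
proof (rule LIMSEQ_I)
  fix e :: real assume e: "e > 0"
  let ?r = "cmod \<mu>"
  obtain K where K: "\<And>k. k \<ge> K \<Longrightarrow> cmod (y k) < e / 2 * (1 - ?r)"
    using LIMSEQ_D[OF y, of "e / 2 * (1 - ?r)"] e \<mu> by auto
  have bound: "cmod (x (K + n)) \<le> ?r ^ n * cmod (x K) + e / 2" for n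
  proof (induction n)
    case 0
    then show ?case using e by simp
  next
    case (Suc n)
    have "cmod (x (K + Suc n)) \<le> ?r * cmod (x (K + n)) + cmod (y (K + n))"
      by (simp add: x norm_triangle_le norm_mult)
    also have "\<dots> \<le> ?r * (?r ^ n * cmod (x K) + e / 2) + e / 2 * (1 - ?r)"
      using Suc K[of "K + n"] by (intro add_mono mult_left_mono) auto
    also have "\<dots> = ?r ^ Suc n * cmod (x K) + e / 2" by (simp add: field_simps)
    finally show ?case .
  qed
  have "(\<lambda>n. ?r ^ n * cmod (x K)) \<longlonglongrightarrow> 0"
    using tendsto_mult_left_zero[OF LIMSEQ_realpow_zero, of ?r] \<mu> by simp
  from LIMSEQ_D[OF this, of "e / 2"] e obtain M where M: "\<And>n. n \<ge> M \<Longrightarrow> ?r ^ n * cmod (x K) < e / 2"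
    by auto
  show "\<exists>no. \<forall>n\<ge>no. norm (x n - 0) < e"
  proof (intro exI allI impI)
    fix n assume n: "n \<ge> K + M"
    then have "cmod (x n) \<le> ?r ^ (n - K) * cmod (x K) + e / 2" using bound[of "n - K"] by simp
    also have "\<dots> < e" using M[of "n - K"] n by linarith
    finally show "norm (x n - 0) < e" by simp
  qed
qed

text \<open>Pairing with the next chain vector obeys a contraction by \<open>\<mu>\<close> whose
  perturbation is the pairing with the previous one, already known to vanish in the limit.\<close>

lemma jordan_chain_tendsto_0:
  assumes A: "invertible A" and w: "jordan_chain A \<mu> m w" and \<mu>: "cmod \<mu> < 1" and j: "j < m"
  shows "(\<lambda>n. cpair (act A (int n) x) (w j)) \<longlonglongrightarrow> 0"
  using j
proof (induction j)
  case 0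
  have "cpair (act A (int (Suc n)) x) (w 0) = \<mu> * cpair (act A (int n) x) (w 0) + 0" for n
    using w act_Suc[OF A, of "int n" x] by (simp add: add.commute cpair_mult jordan_chain_def cpair_smult)
  then show ?case by (rule perturbed_contraction_tendsto_0[OF \<mu> _ tendsto_const])
next
  case (Suc j)
  have "cpair (act A (int (Suc n)) x) (w (Suc j))
      = \<mu> * cpair (act A (int n) x) (w (Suc j)) + cpair (act A (int n) x) (w j)" for n
    using w Suc.prems act_Suc[OF A, of "int n" x]
    by (simp add: add.commute cpair_mult jordan_chain_def cpair_smult cpair_add_right)
  moreover have "(\<lambda>n. cpair (act A (int n) x) (w j)) \<longlonglongrightarrow> 0" using Suc by simp
  ultimately show ?case by (rule perturbed_contraction_tendsto_0[OF \<mu>])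
qed

lemma jordan_chain_tendsto_0_inverse:
  assumes A: "invertible A" and w: "jordan_chain A \<mu> m w" and \<mu>: "cmod \<mu> > 1" and j: "j < m"
  shows "(\<lambda>n. cpair (act A (- int n) x) (w j)) \<longlonglongrightarrow> 0"
  using j
proof (induction j)
  have nz: "\<mu> \<noteq> 0" using \<mu> by auto
  have inv: "cmod (inverse \<mu>) < 1" using \<mu> by (simp add: norm_inverse inverse_less_1_iff)
  have step: "act A (- int n) x = act A (- int (Suc n)) x v* A" for n
    using act_Suc[OF A, of "- int (Suc n)" x] by simp
  {
    case 0
    have "cpair (act A (- int n) x) (w 0) = \<mu> * cpair (act A (- int (Suc n)) x) (w 0)" for n
      using w unfolding step[of n] cpair_mult by (simp add: jordan_chain_def cpair_smult)
    then have "cpair (act A (- int (Suc n)) x) (w 0) = inverse \<mu> * cpair (act A (- int n) x) (w 0) + 0" for n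
      using nz by simp
    then show ?case by (rule perturbed_contraction_tendsto_0[OF inv _ tendsto_const])
  next
    case (Suc j)
    let ?u = "\<lambda>n. cpair (act A (- int n) x)"
    have "?u n (w (Suc j)) = \<mu> * ?u (Suc n) (w (Suc j)) + ?u (Suc n) (w j)" for n
      using w Suc.prems unfolding step[of n] cpair_mult
      by (simp add: jordan_chain_def cpair_smult cpair_add_right)
    \<comment> \<open>Solving the recursion for the earlier point of the orbit turns the expansion
      by \<open>\<mu>\<close> into a contraction by its inverse. The perturbation appears at
      \<open>Suc n\<close>, hence the shift of the limit below.\<close>
    then have *: "?u (Suc n) (w (Suc j)) = inverse \<mu> * ?u n (w (Suc j)) + - inverse \<mu> * ?u (Suc n) (w j)" for n
      using nz by (simp add: distrib_left)
    have "(\<lambda>n. ?u n (w j)) \<longlonglongrightarrow> 0" using Suc by simp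
    then have "(\<lambda>n. - inverse \<mu> * ?u (Suc n) (w j)) \<longlonglongrightarrow> 0"
      by (intro tendsto_mult_right_zero LIMSEQ_Suc)
    with * show ?case by (rule perturbed_contraction_tendsto_0[OF inv])
  }
qed

subsection \<open>The Jordan chains of a real Jordan normal form\<close>

lemma real_jordan_block_dim:
  assumes "real_jordan_block B"
  shows "B \<in> carrier_mat (dim_row B) (dim_row B)" "dim_row B > 0"
  using assms by (auto simp: real_jordan_block_def complex_jordan_block_def)

text \<open>The chain vectors of a block are \<open>e\<^sub>j\<close> in the real and \<open>e\<^sub>2\<^sub>j + i e\<^sub>2\<^sub>j\<^sub>+\<^sub>1\<close> in the complex case.\<close>

lemma real_jordan_block_chain:
  assumes "real_jordan_block B"
  obtains \<mu> :: complex and m :: nat and f :: "nat \<Rightarrow> nat \<Rightarrow> complex"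
  where "0 < m" "f 0 0 \<noteq> 0"
    "\<And>j r. j < m \<Longrightarrow> r < dim_row B \<Longrightarrow> (\<Sum>b<dim_row B. complex_of_real (B $$ (r, b)) * f j b)
        = \<mu> * f j r + (if j = 0 then 0 else f (j - 1) r)"
    "\<And>b. b < dim_row B \<Longrightarrow> \<exists>j<m. (\<forall>r. Re (f j r) = of_bool (r = b)) \<or> (\<forall>r. Im (f j r) = of_bool (r = b))"
    "cmod \<mu> = 1 \<Longrightarrow> m = 1 \<Longrightarrow> B * transpose_mat B = 1\<^sub>m (dim_row B)"
proof -
  from assms consider (real) m \<alpha> where "m > 0" "B = jordan_block m \<alpha>"
    | (cplx) m \<alpha> \<beta> where "m > 0" "\<beta> \<noteq> 0" "B = complex_jordan_block m \<alpha> \<beta>"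
    unfolding real_jordan_block_def by blast
  then show ?thesis
  proof cases
    case real
    let ?f = "\<lambda>j r. of_bool (r = j) :: complex"
    have sum: "(\<Sum>b<dim_row B. complex_of_real (B $$ (r, b)) * ?f j b) = B $$ (r, j)" if "j < m" for j r
    proof -
      have "(\<Sum>b<dim_row B. complex_of_real (B $$ (r, b)) * ?f j b)
          = (\<Sum>b<dim_row B. if b = j then complex_of_real (B $$ (r, b)) else 0)"
        by (intro sum.cong) auto
      then show ?thesis using that real by simp
    qed
    show ?thesis
    proof (rule that[of m ?f "complex_of_real \<alpha>"])
      show "(\<Sum>b<dim_row B. complex_of_real (B $$ (r, b)) * ?f j b)
          = complex_of_real \<alpha> * ?f j r + (if j = 0 then 0 else ?f (j - 1) r)"
        if "j < m" "r < dim_row B" for j r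
        using that real by (subst sum) auto
      show "\<exists>j<m. (\<forall>r. Re (?f j r) = of_bool (r = b)) \<or> (\<forall>r. Im (?f j r) = of_bool (r = b))"
        if "b < dim_row B" for b
        using that real by (intro exI[of _ b]) auto
      show "B * transpose_mat B = 1\<^sub>m (dim_row B)" if "cmod (complex_of_real \<alpha>) = 1" "m = 1"
      proof -
        have "\<alpha> * \<alpha> = 1" using that(1) by (auto simp: abs_if split: if_splits)
        then show ?thesis
          using that(2) real by (intro eq_matI) (auto simp: scalar_prod_def)
      qed
    qed (use real in auto)
  next
    case cplx
    let ?f = "\<lambda>j r. of_bool (r = 2 * j) + \<i> * of_bool (r = Suc (2 * j)) :: complex"
    have dim: "dim_row B = 2 * m" "dim_col B = 2 * m"
      using cplx by (simp_all add: complex_jordan_block_def)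
    have sum: "(\<Sum>b<dim_row B. complex_of_real (B $$ (r, b)) * ?f j b)
        = B $$ (r, 2 * j) + \<i> * B $$ (r, Suc (2 * j))" if "j < m" for j r
    proof -
      have "(\<Sum>b<dim_row B. complex_of_real (B $$ (r, b)) * ?f j b)
          = (\<Sum>b<dim_row B. if b = 2 * j then complex_of_real (B $$ (r, b)) else 0)
          + (\<Sum>b<dim_row B. if b = Suc (2 * j) then \<i> * complex_of_real (B $$ (r, b)) else 0)"
        unfolding sum.distrib[symmetric] by (intro sum.cong) auto
      then show ?thesis using that dim by simp
    qed
    \<comment> \<open>The eigenvalue is \<open>Complex \<alpha> \<beta>\<close> and not its
      conjugate: \<open>D\<close> sends the column (1, i) to (\<alpha> + i \<beta>, -\<beta> + i
      \<alpha>), which is (\<alpha> + i \<beta>) times (1, i).\<close>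
    show ?thesis
    proof (rule that[of m ?f "Complex \<alpha> \<beta>"])
      show "(\<Sum>b<dim_row B. complex_of_real (B $$ (r, b)) * ?f j b)
          = Complex \<alpha> \<beta> * ?f j r + (if j = 0 then 0 else ?f (j - 1) r)"
        if jr: "j < m" "r < dim_row B" for j r
      proof -
        \<comment> \<open>\<open>q\<close> is the number of the 2 x 2 block row and \<open>s\<close>
          the place within it; all conditions on entries are rewritten in these terms.\<close>
        obtain q s where r: "r = 2 * q + s" "s < 2"
          by (metis mod_less_divisor mult_div_mod_eq zero_less_numeral)
        then have s: "s = 0 \<or> s = 1" by auto
        have entry: "B $$ (r, c) = (if r div 2 = c div 2 then
             (if r = c then \<alpha> else if r < c then \<beta> else - \<beta>)
           else if Suc (r div 2) = c div 2 then (if r mod 2 = c mod 2 then 1 else 0) else 0)"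
          if "c < 2 * m" for c
          using that jr(2) dim cplx by (simp add: complex_jordan_block_def)
        have "2 * j < 2 * m" "Suc (2 * j) < 2 * m" using jr by auto
        note e = entry[OF this(1)] entry[OF this(2)]
        have r_div: "r div 2 = q" "r mod 2 = s" using r by auto
        have r_iff: "r = 2 * k \<longleftrightarrow> q = k \<and> s = 0" "r = Suc (2 * k) \<longleftrightarrow> q = k \<and> s = 1" for k
          using r by presburger+
        have "B $$ (r, 2 * j) = (if q = j then (if s = 0 then \<alpha> else - \<beta>) else of_bool (Suc q = j \<and> s = 0))"
          unfolding e(1) r_div r_iff using r by auto
        moreover have "B $$ (r, Suc (2 * j)) = (if q = j then (if s = 0 then \<beta> else \<alpha>) else of_bool (Suc q = j \<and> s = 1))"
          unfolding e(2) r_div r_iff using r s by auto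
        ultimately have "B $$ (r, 2 * j) + \<i> * B $$ (r, Suc (2 * j))
            = Complex \<alpha> \<beta> * ?f j r + (if j = 0 then 0 else ?f (j - 1) r)"
          unfolding r_iff using s by (cases j) (auto simp: complex_eq_iff)
        with sum[OF jr(1)] show ?thesis by (rule trans)
      qed
      show "\<exists>j<m. (\<forall>r. Re (?f j r) = of_bool (r = b)) \<or> (\<forall>r. Im (?f j r) = of_bool (r = b))"
        if "b < dim_row B" for b
      proof -
        \<comment> \<open>Even places are read off by the real part of a chain vector, odd ones by
          its imaginary part.\<close>
        have "b = 2 * (b div 2) \<or> b = Suc (2 * (b div 2))" by presburger
        then obtain k where k: "b = 2 * k \<or> b = Suc (2 * k)" by blast
        then have "k < m" using that dim by auto
        with k show ?thesis by (intro exI[of _ k]) auto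
      qed
      show "B * transpose_mat B = 1\<^sub>m (dim_row B)" if "cmod (Complex \<alpha> \<beta>) = 1" "m = 1"
      proof (rule eq_matI)
        have "\<alpha> * \<alpha> + \<beta> * \<beta> = 1" using that(1) by (simp add: cmod_def power2_eq_square)
        moreover have "B $$ (0, 0) = \<alpha>" "B $$ (0, 1) = \<beta>" "B $$ (1, 0) = - \<beta>" "B $$ (1, 1) = \<alpha>"
          using that(2) cplx by (simp_all add: complex_jordan_block_def)
        moreover fix i j assume "i < dim_row (1\<^sub>m (dim_row B) :: real mat)" "j < dim_col (1\<^sub>m (dim_row B) :: real mat)"
        then have ij: "i < 2" "j < 2" using dim that(2) by auto
        then have "(B * transpose_mat B) $$ (i, j) = B $$ (i, 0) * B $$ (j, 0) + B $$ (i, 1) * B $$ (j, 1)"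
          using dim that(2) by (simp add: scalar_prod_def numeral_2_eq_2)
        ultimately show "(B * transpose_mat B) $$ (i, j) = 1\<^sub>m (dim_row B) $$ (i, j)"
          using ij dim that(2) by (auto simp: less_2_cases_iff add.commute)
      qed (use dim in auto)
    qed (use cplx in auto)
  qed
qed

section \<open>Block diagonal matrices\<close>

lemma dim_col_diag_block_mat_square:
  assumes "\<forall>B\<in>set Bs. B \<in> carrier_mat (dim_row B) (dim_row B)"
  shows "dim_col (diag_block_mat Bs) = sum_list (map dim_row Bs)"
  using assms by (induction Bs) (auto simp: Let_def)

text \<open>Only columns through \<open>B\<close> are described: a chain vector supported on the
  positions of \<open>B\<close> is multiplied with no others.\<close>

lemma diag_block_mat_index:
  assumes "\<forall>B\<in>set (xs @ B # ys). B \<in> carrier_mat (dim_row B) (dim_row B)"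
    and "s = sum_list (map dim_row xs)" "a < sum_list (map dim_row (xs @ B # ys))" "b < dim_row B"
  shows "diag_block_mat (xs @ B # ys) $$ (a, s + b)
    = (if s \<le> a \<and> a < s + dim_row B then B $$ (a - s, b) else (0::'a::zero))"
  using assms
proof (induction xs arbitrary: a s)
  case Nil
  then have "dim_col B = dim_row B" "dim_col (diag_block_mat ys) = dim_row (diag_block_mat ys)"
    using dim_col_diag_block_mat_square[of ys] by (auto simp: dim_diag_block_mat(1))
  with Nil show ?case
    by (auto simp: Let_def dim_diag_block_mat(1))
next
  case (Cons C xs)
  have dims: "dim_col C = dim_row C" "dim_row (diag_block_mat (xs @ B # ys)) = sum_list (map dim_row (xs @ B # ys))"
    "dim_col (diag_block_mat (xs @ B # ys)) = sum_list (map dim_row (xs @ B # ys))"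
    using Cons.prems(1) dim_col_diag_block_mat_square[of "xs @ B # ys"] by (auto simp: dim_diag_block_mat(1))
  show ?case
  proof (cases "a < dim_row C")
    case True
    with Cons.prems dims show ?thesis by (auto simp: Let_def)
  next
    case False
    let ?s = "sum_list (map dim_row xs)"
    have a: "a - dim_row C < sum_list (map dim_row (xs @ B # ys))"
      and s: "s = dim_row C + ?s" and b: "b < dim_row B"
      using False Cons.prems by auto
    have "diag_block_mat ((C # xs) @ B # ys) $$ (a, s + b) = diag_block_mat (xs @ B # ys) $$ (a - dim_row C, ?s + b)"
      using False a b dims by (simp add: Let_def s del: sum_list.append map_append) simp
    also have "\<dots> = (if ?s \<le> a - dim_row C \<and> a - dim_row C < ?s + dim_row B then B $$ (a - dim_row C - ?s, b) else 0)"
      using Cons.prems(1) by (intro Cons.IH refl a b) auto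
    also have "\<dots> = (if s \<le> a \<and> a < s + dim_row B then B $$ (a - s, b) else 0)"
      using False by (intro if_cong) (auto simp: s)
    finally show ?thesis .
  qed
qed

lemma sum_list_dims_split:
  assumes "p < sum_list (map dim_row Bs)"
  obtains xs B ys b where "Bs = xs @ B # ys" "b < dim_row B" "p = sum_list (map dim_row xs) + b"
  using assms
proof (induction Bs arbitrary: p thesis)
  case Nil
  then show ?case by simp
next
  case (Cons C Bs)
  show ?case
  proof (cases "p < dim_row C")
    case True
    then show ?thesis using Cons.prems(1)[of "[]" C Bs p] by simp
  next
    case False
    with Cons.prems(2) have "p - dim_row C < sum_list (map dim_row Bs)" by simp
    from Cons.IH[OF _ this] obtain xs B ys b where "Bs = xs @ B # ys" "b < dim_row B"
      "p - dim_row C = sum_list (map dim_row xs) + b" by blast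
    with False show ?thesis using Cons.prems(1)[of "C # xs" B ys b] by simp
  qed
qed

lemma diag_block_mat_orthogonal:
  fixes Bs :: "real mat list"
  assumes "\<forall>B\<in>set Bs. B \<in> carrier_mat (dim_row B) (dim_row B) \<and> B * transpose_mat B = 1\<^sub>m (dim_row B)"
  shows "diag_block_mat Bs * transpose_mat (diag_block_mat Bs) = 1\<^sub>m (sum_list (map dim_row Bs))"
  using assms
proof (induction Bs)
  case Nil
  then show ?case by (intro eq_matI) auto
next
  case (Cons C Bs)
  let ?D = "diag_block_mat Bs" and ?n = "sum_list (map dim_row Bs)" and ?c = "dim_row C"
  have dims: "dim_row ?D = ?n" "dim_col ?D = ?n" "dim_col C = ?c"
    using Cons.prems dim_col_diag_block_mat_square[of Bs] by (auto simp: dim_diag_block_mat(1))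
  then have C: "C \<in> carrier_mat ?c ?c" and D: "?D \<in> carrier_mat ?n ?n" by auto
  have "diag_block_mat (C # Bs) = four_block_mat C (0\<^sub>m ?c ?n) (0\<^sub>m ?n ?c) ?D"
    by (simp add: Let_def dims)
  moreover have "four_block_mat C (0\<^sub>m ?c ?n) (0\<^sub>m ?n ?c) ?D
      * transpose_mat (four_block_mat C (0\<^sub>m ?c ?n) (0\<^sub>m ?n ?c) ?D)
      = four_block_mat (C * transpose_mat C) (0\<^sub>m ?c ?n) (0\<^sub>m ?n ?c) (?D * transpose_mat ?D)"
  proof -
    have "transpose_mat (four_block_mat C (0\<^sub>m ?c ?n) (0\<^sub>m ?n ?c) ?D)
        = four_block_mat (transpose_mat C) (0\<^sub>m ?c ?n) (0\<^sub>m ?n ?c) (transpose_mat ?D)"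
      by (subst transpose_four_block_mat[OF C zero_carrier_mat zero_carrier_mat D]) simp
    moreover have Ct: "transpose_mat C \<in> carrier_mat ?c ?c" "transpose_mat ?D \<in> carrier_mat ?n ?n"
      by (simp_all only: transpose_carrier_mat C D)
    moreover have "four_block_mat C (0\<^sub>m ?c ?n) (0\<^sub>m ?n ?c) ?D
        * four_block_mat (transpose_mat C) (0\<^sub>m ?c ?n) (0\<^sub>m ?n ?c) (transpose_mat ?D)
      = four_block_mat (C * transpose_mat C + 0\<^sub>m ?c ?n * 0\<^sub>m ?n ?c) (C * 0\<^sub>m ?c ?n + 0\<^sub>m ?c ?n * transpose_mat ?D)
          (0\<^sub>m ?n ?c * transpose_mat C + ?D * 0\<^sub>m ?n ?c) (0\<^sub>m ?n ?c * 0\<^sub>m ?c ?n + ?D * transpose_mat ?D)"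
      by (rule mult_four_block_mat[OF C zero_carrier_mat zero_carrier_mat D
            Ct(1) zero_carrier_mat zero_carrier_mat Ct(2)])
    moreover have "C * transpose_mat C \<in> carrier_mat ?c ?c" "?D * transpose_mat ?D \<in> carrier_mat ?n ?n"
      by (rule mult_carrier_mat[OF C Ct(1)] mult_carrier_mat[OF D Ct(2)])+
    ultimately show ?thesis
      by (simp only: left_mult_zero_mat[OF Ct(1)] left_mult_zero_mat[OF Ct(2)] left_mult_zero_mat[OF zero_carrier_mat]
          right_mult_zero_mat[OF C] right_mult_zero_mat[OF D]
          left_add_zero_mat[OF zero_carrier_mat] left_add_zero_mat right_add_zero_mat)
  qed
  moreover have "C * transpose_mat C = 1\<^sub>m ?c" "?D * transpose_mat ?D = 1\<^sub>m ?n"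
    using Cons by auto
  ultimately show ?case by simp
qed

section \<open>Passage between the index type and the positions 0, ..., n - 1\<close>

definition idx :: "nat \<Rightarrow> 'n::{finite,linorder}" where
  "idx k = sorted_list_of_set UNIV ! k"

definition pos :: "'n::{finite,linorder} \<Rightarrow> nat" where
  "pos = inv_into {..<CARD('n)} idx"

lemma bij_betw_idx: "bij_betw (idx :: nat \<Rightarrow> 'n::{finite,linorder}) {..<CARD('n)} UNIV"
  unfolding idx_def[abs_def] by (rule bij_betw_nth) auto

lemma pos_less: "pos (i :: 'n::{finite,linorder}) < CARD('n)"
  using inv_into_into[of i idx "{..<CARD('n)}"] bij_betw_idx[where 'n = 'n]
  by (auto simp: pos_def bij_betw_def)

lemma idx_pos [simp]: "idx (pos i) = i"
  unfolding pos_def by (rule bij_betw_inv_into_right[OF bij_betw_idx UNIV_I])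

lemma pos_idx: "k < CARD('n) \<Longrightarrow> pos (idx k :: 'n::{finite,linorder}) = k"
  unfolding pos_def by (rule bij_betw_inv_into_left[OF bij_betw_idx]) simp

lemma sum_idx: "(\<Sum>i\<in>UNIV. g (i :: 'n::{finite,linorder})) = (\<Sum>k<CARD('n). g (idx k))"
  by (rule sum.reindex_bij_betw[OF bij_betw_idx, symmetric])

lemma mat_of_matrix_index:
  fixes A :: "real^'n::{finite,linorder}^'n::{finite,linorder}"
  assumes "a < CARD('n)" "b < CARD('n)"
  shows "mat_of_matrix A $$ (a, b) = A $ idx a $ idx b"
  using assms by (simp add: mat_of_matrix_def idx_def)

lemma dim_mat_of_matrix [simp]:
  fixes A :: "real^'n::{finite,linorder}^'n::{finite,linorder}"
  shows "dim_row (mat_of_matrix A) = CARD('n)" "dim_col (mat_of_matrix A) = CARD('n)"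
  by (simp_all add: mat_of_matrix_def)

text \<open>Eigenvectors are transported between the two kinds of vectors along the bijection
  \<open>idx\<close> and its inverse \<open>pos\<close>.\<close>

lemma complex_eigenvalue_iff:
  fixes A :: "real^'n::{finite,linorder}^'n::{finite,linorder}"
  shows "complex_eigenvalue A z \<longleftrightarrow> (\<exists>v. v \<noteq> 0 \<and> cmat A *v v = z *s v)"
proof
  let ?N = "CARD('n)"
  let ?M = "map_mat complex_of_real (mat_of_matrix A)"
  {
    assume "complex_eigenvalue A z"
    then obtain u where u: "u \<in> carrier_vec ?N" "u \<noteq> 0\<^sub>v ?N" "?M *\<^sub>v u = z \<cdot>\<^sub>v u"
      unfolding complex_eigenvalue_def eigenvalue_def eigenvector_def by auto
    let ?v = "\<chi> i::'n. vec_index u (pos i)"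
    have "cmat A *v ?v = z *s ?v"
    proof (subst Finite_Cartesian_Product.vec_eq_iff, rule allI)
      fix i :: 'n
      have "(cmat A *v ?v) $ i = (\<Sum>k<?N. complex_of_real (A $ idx (pos i) $ idx k) * vec_index u k)"
        by (simp add: matrix_vector_mult_def cmat_def sum_idx pos_idx)
      also have "\<dots> = vec_index (?M *\<^sub>v u) (pos i)"
        using u(1) pos_less[of i]
        by (simp add: scalar_prod_def mat_of_matrix_index atLeast0LessThan)
      also have "\<dots> = (z *s ?v) $ i"
        using u(1) pos_less[of i] by (simp add: u(3))
      finally show "(cmat A *v ?v) $ i = (z *s ?v) $ i" .
    qed
    moreover have "?v \<noteq> 0"
    proof
      assume 0: "?v = 0"
      have "vec_index u k = 0" if "k < ?N" for k
      proof -
        have "?v $ idx k = 0" unfolding 0 by simp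
        then show ?thesis using that by (simp add: pos_idx)
      qed
      then have "u = 0\<^sub>v ?N" using u(1) by (intro eq_vecI) auto
      with u(2) show False by simp
    qed
    ultimately show "\<exists>v. v \<noteq> 0 \<and> cmat A *v v = z *s v" by blast
  }
  {
    assume "\<exists>v. v \<noteq> 0 \<and> cmat A *v v = z *s v"
    then obtain v where v: "v \<noteq> 0" "cmat A *v v = z *s v" by blast
    let ?u = "Matrix.vec ?N (\<lambda>k. v $ idx k)"
    have "?M *\<^sub>v ?u = z \<cdot>\<^sub>v ?u"
    proof (rule eq_vecI)
      fix k assume "k < dim_vec (z \<cdot>\<^sub>v ?u)"
      then have k: "k < ?N" by simp
      have "vec_index (?M *\<^sub>v ?u) k = (cmat A *v v) $ idx k"
        using k by (simp add: scalar_prod_def mat_of_matrix_index atLeast0LessThan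
            matrix_vector_mult_def cmat_def sum_idx)
      then show "vec_index (?M *\<^sub>v ?u) k = vec_index (z \<cdot>\<^sub>v ?u) k"
        using k by (simp add: v(2))
    qed simp
    moreover have "?u \<noteq> 0\<^sub>v ?N"
    proof
      assume 0: "?u = 0\<^sub>v ?N"
      have "v $ i = 0" for i
      proof -
        have "vec_index ?u (pos i) = 0" unfolding 0 using pos_less[of i] by simp
        then show ?thesis using pos_less[of i] by simp
      qed
      with v(1) show False by (simp add: Finite_Cartesian_Product.vec_eq_iff)
    qed
    ultimately show "complex_eigenvalue A z"
      unfolding complex_eigenvalue_def eigenvalue_def eigenvector_def
      by (intro exI[of _ ?u]) simp
  }
qed

text \<open>The chain of the block is extended by zero; block diagonality keeps the image supported
  on the same positions. The second conclusion recovers the coordinates in the block from pairings,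
  the third serves to recognise orthogonal matrices.\<close>

lemma jordan_chain_of_block:
  fixes A :: "real^'n::{finite,linorder}^'n::{finite,linorder}"
  assumes M: "mat_of_matrix A = diag_block_mat (xs @ B # ys)"
    and blocks: "\<forall>B\<in>set (xs @ B # ys). real_jordan_block B"
  obtains \<mu> m w where "jordan_chain A \<mu> m w"
    "\<And>b. b < dim_row B \<Longrightarrow> \<exists>j<m. (\<forall>x. x $ idx (sum_list (map dim_row xs) + b) = Re (cpair x (w j)))
        \<or> (\<forall>x. x $ idx (sum_list (map dim_row xs) + b) = Im (cpair x (w j)))"
    "cmod \<mu> = 1 \<Longrightarrow> m = 1 \<Longrightarrow> B * transpose_mat B = 1\<^sub>m (dim_row B)"
proof -
  let ?N = "CARD('n)" and ?s = "sum_list (map dim_row xs)" and ?d = "dim_row B"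
  have B: "real_jordan_block B" using blocks by simp
  have sq: "\<forall>B\<in>set (xs @ B # ys). B \<in> carrier_mat (dim_row B) (dim_row B)"
    using blocks real_jordan_block_dim(1) by blast
  have N: "?N = sum_list (map dim_row (xs @ B # ys))"
    using arg_cong[OF M, of dim_row] by (simp only: dim_mat_of_matrix dim_diag_block_mat)
  then have sd: "?s + ?d \<le> ?N" by simp
  show ?thesis
  proof (rule real_jordan_block_chain[OF B])
    fix \<mu> :: complex and m :: nat and f :: "nat \<Rightarrow> nat \<Rightarrow> complex"
    assume m: "0 < m" and f0: "f 0 0 \<noteq> 0"
      and f: "\<And>j r. j < m \<Longrightarrow> r < ?d \<Longrightarrow> (\<Sum>b<?d. complex_of_real (B $$ (r, b)) * f j b)
        = \<mu> * f j r + (if j = 0 then 0 else f (j - 1) r)"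
      and coord: "\<And>b. b < ?d \<Longrightarrow> \<exists>j<m. (\<forall>r. Re (f j r) = of_bool (r = b)) \<or> (\<forall>r. Im (f j r) = of_bool (r = b))"
      and orth: "cmod \<mu> = 1 \<Longrightarrow> m = 1 \<Longrightarrow> B * transpose_mat B = 1\<^sub>m ?d"
    define w :: "nat \<Rightarrow> (complex, 'n) Finite_Cartesian_Product.vec" where
      "w j = (\<chi> i. if ?s \<le> pos i \<and> pos i < ?s + ?d then f j (pos i - ?s) else 0)" for j
    have Aw: "(cmat A *v w j) $ i = (\<mu> *s w j) $ i + (if j = 0 then 0 else w (j - 1) $ i)" if j: "j < m" for i j
    proof -
      have "(cmat A *v w j) $ i = (\<Sum>k<?N. complex_of_real (mat_of_matrix A $$ (pos i, k))
          * (if ?s \<le> k \<and> k < ?s + ?d then f j (k - ?s) else 0))"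
        unfolding matrix_vector_mult_def cmat_def w_def vec_lambda_beta sum_idx
        by (intro sum.cong refl) (simp add: pos_idx mat_of_matrix_index pos_less)
      also have "\<dots> = (\<Sum>k\<in>{?s..<?s + ?d}. complex_of_real (mat_of_matrix A $$ (pos i, k)) * f j (k - ?s))"
        using sd by (intro sum.mono_neutral_cong_right) auto
      also have "\<dots> = (\<Sum>b<?d. complex_of_real (mat_of_matrix A $$ (pos i, ?s + b)) * f j b)"
        by (rule sum.reindex_bij_witness[of _ "\<lambda>b. ?s + b" "\<lambda>k. k - ?s"]) auto
      also have "\<dots> = (\<Sum>b<?d. complex_of_real (if ?s \<le> pos i \<and> pos i < ?s + ?d then B $$ (pos i - ?s, b) else 0) * f j b)"
        using pos_less[of i] unfolding M N
        by (intro sum.cong refl) (simp only: lessThan_iff diag_block_mat_index[OF sq refl])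
      also have "\<dots> = (if ?s \<le> pos i \<and> pos i < ?s + ?d then \<mu> * f j (pos i - ?s)
          + (if j = 0 then 0 else f (j - 1) (pos i - ?s)) else 0)"
        using f[OF j, of "pos i - ?s"] by auto
      also have "\<dots> = (\<mu> *s w j) $ i + (if j = 0 then 0 else w (j - 1) $ i)"
        by (simp add: w_def)
      finally show ?thesis .
    qed
    \<comment> \<open>Blocks are nonempty, so the first position of the block exists, and there the
      value is \<open>f 0 0\<close>.\<close>
    have "w 0 $ idx ?s \<noteq> 0"
      using f0 sd real_jordan_block_dim(2)[OF B] by (simp add: w_def pos_idx)
    then have "w 0 \<noteq> 0" by auto
    then have chain: "jordan_chain A \<mu> m w"
      using m Aw[of 0] Aw[of "Suc j" for j]
      by (auto simp: jordan_chain_def Finite_Cartesian_Product.vec_eq_iff)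
    have "\<exists>j<m. (\<forall>x. x $ idx (?s + b) = Re (cpair x (w j))) \<or> (\<forall>x. x $ idx (?s + b) = Im (cpair x (w j)))"
      if b: "b < ?d" for b
    proof -
      have "?s + b < ?N" using b sd by simp
      then have idx_iff: "i = idx (?s + b) \<longleftrightarrow> pos i = ?s + b" for i :: 'n
        using pos_idx idx_pos by metis
      from coord[OF b] obtain j where j: "j < m"
        and "(\<forall>r. Re (f j r) = of_bool (r = b)) \<or> (\<forall>r. Im (f j r) = of_bool (r = b))" by blast
      from this(2) show ?thesis
      proof
        assume "\<forall>r. Re (f j r) = of_bool (r = b)"
        then have "Re (w j $ i) = of_bool (i = idx (?s + b))" for i
          using b by (auto simp: w_def idx_iff)
        then have "x $ idx (?s + b) = Re (cpair x (w j))" for x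
          by (simp add: cpair_def)
        with j show ?thesis by blast
      next
        assume "\<forall>r. Im (f j r) = of_bool (r = b)"
        then have "Im (w j $ i) = of_bool (i = idx (?s + b))" for i
          using b by (auto simp: w_def idx_iff)
        then have "x $ idx (?s + b) = Im (cpair x (w j))" for x
          by (simp add: cpair_def)
        with j show ?thesis by blast
      qed
    qed
    from chain this orth show ?thesis by (rule that)
  qed
qed

text \<open>Each index lies in some block, so the chains of all blocks together see every
  coordinate. Convergence of the pairings thus yields convergence of the vector.\<close>

lemma jordan_chain_coordinate:
  fixes A :: "real^'n::{finite,linorder}^'n::{finite,linorder}"
  assumes "real_jordan_normal_form A"
  shows "\<exists>\<mu> m w j. jordan_chain A \<mu> m w \<and> j < m \<and>
    ((\<forall>x. x $ i = Re (cpair x (w j))) \<or> (\<forall>x. x $ i = Im (cpair x (w j))))"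
proof -
  from assms obtain Bs where blocks: "\<forall>B\<in>set Bs. real_jordan_block B" and M: "mat_of_matrix A = diag_block_mat Bs"
    by (auto simp: real_jordan_normal_form_def)
  have "CARD('n) = sum_list (map dim_row Bs)"
    using arg_cong[OF M, of dim_row] by (simp only: dim_mat_of_matrix dim_diag_block_mat)
  then have "pos i < sum_list (map dim_row Bs)" using pos_less[of i] by simp
  then obtain xs B ys b where Bs: "Bs = xs @ B # ys" and b: "b < dim_row B"
    and p: "pos i = sum_list (map dim_row xs) + b"
    by (rule sum_list_dims_split)
  from jordan_chain_of_block[OF M[unfolded Bs] blocks[unfolded Bs]] obtain \<mu> m w
    where "jordan_chain A \<mu> m w"
    "\<And>b. b < dim_row B \<Longrightarrow> \<exists>j<m. (\<forall>x. x $ idx (sum_list (map dim_row xs) + b) = Re (cpair x (w j)))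
        \<or> (\<forall>x. x $ idx (sum_list (map dim_row xs) + b) = Im (cpair x (w j)))"
    by metis
  from this(1) this(2)[OF b] show ?thesis
    unfolding p[symmetric] idx_pos by blast
qed

text \<open>If every chain had length one and an eigenvalue of modulus 1, every block would be
  orthogonal, and then so would the matrix.\<close>

lemma jordan_chain_nonorthogonal:
  fixes A :: "real^'n::{finite,linorder}^'n::{finite,linorder}"
  assumes "real_jordan_normal_form A" and "\<not> orthogonal_matrix A"
  shows "\<exists>\<mu> m w. jordan_chain A \<mu> m w \<and> (cmod \<mu> \<noteq> 1 \<or> m \<noteq> 1)"
proof (rule ccontr)
  assume neg: "\<not> ?thesis"
  let ?M = "mat_of_matrix A"
  from assms obtain Bs where blocks: "\<forall>B\<in>set Bs. real_jordan_block B" and M: "?M = diag_block_mat Bs"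
    by (auto simp: real_jordan_normal_form_def)
  have N: "CARD('n) = sum_list (map dim_row Bs)"
    using arg_cong[OF M, of dim_row] by (simp only: dim_mat_of_matrix dim_diag_block_mat)
  have "\<forall>B\<in>set Bs. B \<in> carrier_mat (dim_row B) (dim_row B) \<and> B * transpose_mat B = 1\<^sub>m (dim_row B)"
  proof
    fix B assume B: "B \<in> set Bs"
    then obtain xs ys where Bs: "Bs = xs @ B # ys" by (meson split_list)
    from jordan_chain_of_block[OF M[unfolded Bs] blocks[unfolded Bs]] neg
    have "B * transpose_mat B = 1\<^sub>m (dim_row B)" by metis
    with B blocks real_jordan_block_dim(1)
    show "B \<in> carrier_mat (dim_row B) (dim_row B) \<and> B * transpose_mat B = 1\<^sub>m (dim_row B)" by blast
  qed
  from diag_block_mat_orthogonal[OF this] have orth: "?M * transpose_mat ?M = 1\<^sub>m CARD('n)"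
    by (simp add: M N)
  have "A ** Finite_Cartesian_Product.transpose A = Finite_Cartesian_Product.mat 1"
  proof -
    have "(A ** Finite_Cartesian_Product.transpose A) $ i $ j = of_bool (i = j)" for i j
    proof -
      have "(A ** Finite_Cartesian_Product.transpose A) $ i $ j
          = (\<Sum>k<CARD('n). ?M $$ (pos i, k) * ?M $$ (pos j, k))"
        by (simp add: matrix_matrix_mult_def Finite_Cartesian_Product.transpose_def sum_idx
            mat_of_matrix_index pos_less)
      also have "\<dots> = (?M * transpose_mat ?M) $$ (pos i, pos j)"
        by (simp add: scalar_prod_def pos_less atLeast0LessThan)
      also have "\<dots> = of_bool (pos i = pos j)"
        unfolding orth by (simp add: pos_less)
      also have "pos i = pos j \<longleftrightarrow> i = j"
        by (metis idx_pos)
      finally show ?thesis .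
    qed
    then show ?thesis
      by (simp add: Finite_Cartesian_Product.vec_eq_iff Finite_Cartesian_Product.mat_def)
  qed
  then have "orthogonal_matrix A"
    by (simp add: orthogonal_matrix_def matrix_left_right_inverse)
  with assms(2) show False by simp
qed

lemma jordan_chain_imp_eigenvalue: "jordan_chain A \<mu> m w \<Longrightarrow> complex_eigenvalue A \<mu>"
  by (auto simp: jordan_chain_def complex_eigenvalue_iff)

section \<open>The equivalences\<close>

lemma bounded_cross_section_iff_eigenvalues:
  fixes A :: "real^'n::{finite,linorder}^'n::{finite,linorder}"
  assumes A: "invertible A" and J: "real_jordan_normal_form A"
  shows "(\<exists>S. cross_section A S \<and> bounded S) \<longleftrightarrow>
       (\<forall>z. complex_eigenvalue A z \<longrightarrow> cmod z > 1) \<or> (\<forall>z. complex_eigenvalue A z \<longrightarrow> cmod z < 1)"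
proof
  assume "\<exists>S. cross_section A S \<and> bounded S"
  then obtain S where S: "cross_section A S" "bounded S" by blast
  have "emeasure lebesgue S < \<infinity>"
    using emeasure_bounded_finite[OF S(2)] cross_sectionD(1)[OF A S(1)] by simp
  with infinite_cross_section[OF A _ S(1)] have "\<bar>Determinants.det A\<bar> < 1 \<or> \<bar>Determinants.det A\<bar> > 1" by force
  \<comment> \<open>The side of 1 on which the modulus of the determinant lies fixes the time
    direction, and with it the alternative that all eigenvalues share.\<close>
  then consider "\<bar>Determinants.det A\<bar> powi 1 < 1" | "\<bar>Determinants.det A\<bar> powi (-1) < 1"
    by (auto simp: power_int_minus inverse_less_1_iff)
  then show "(\<forall>z. complex_eigenvalue A z \<longrightarrow> cmod z > 1) \<or> (\<forall>z. complex_eigenvalue A z \<longrightarrow> cmod z < 1)"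
  proof cases
    case 1
    have "cmod z < 1" if "complex_eigenvalue A z" for z
      using that bounded_cross_section_eigenvalue[OF A S _ _ _ 1]
      by (auto simp: complex_eigenvalue_iff)
    then show ?thesis by blast
  next
    case 2
    have "cmod z > 1" if "complex_eigenvalue A z" for z
    proof -
      from that obtain v where v: "v \<noteq> 0" "cmat A *v v = z *s v"
        by (auto simp: complex_eigenvalue_iff)
      from bounded_cross_section_eigenvalue[OF A S v _ 2] eigenvalue_nonzero[OF A v]
      show ?thesis by (auto simp: power_int_minus inverse_less_1_iff)
    qed
    then show ?thesis by blast
  qed
next
  assume ev: "(\<forall>z. complex_eigenvalue A z \<longrightarrow> cmod z > 1) \<or> (\<forall>z. complex_eigenvalue A z \<longrightarrow> cmod z < 1)"
  \<comment> \<open>Any coordinate provides a chain, hence an eigenvalue, which \<open>ev\<close>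
    places off the unit circle: so there is a cross-section to be moved.\<close>
  from jordan_chain_coordinate[OF J] obtain \<mu> m w where chain: "jordan_chain A \<mu> m w" by blast
  with ev have "cmod \<mu> \<noteq> 1" by (auto dest: jordan_chain_imp_eigenvalue)
  moreover from chain have "w 0 \<noteq> 0" "cmat A *v w 0 = \<mu> *s w 0" by (auto simp: jordan_chain_def)
  ultimately obtain S where S: "cross_section A S"
    using cross_section_of_eigenvector[OF A] by blast
  have lim: "(\<lambda>n. act A (\<sigma> * int n) x) \<longlonglongrightarrow> 0"
    if \<sigma>: "\<And>\<mu> m w j. jordan_chain A \<mu> m w \<Longrightarrow> j < m \<Longrightarrow> (\<lambda>n. cpair (act A (\<sigma> * int n) x) (w j)) \<longlonglongrightarrow> 0" for \<sigma> x
  proof (rule vec_tendstoI)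
    fix i :: 'n
    from jordan_chain_coordinate[OF J, of i] obtain \<mu> m w j where "jordan_chain A \<mu> m w" "j < m"
      and c: "(\<forall>x. x $ i = Re (cpair x (w j))) \<or> (\<forall>x. x $ i = Im (cpair x (w j)))" by blast
    from \<sigma>[OF this(1,2)] have "(\<lambda>n. Re (cpair (act A (\<sigma> * int n) x) (w j))) \<longlonglongrightarrow> 0"
      "(\<lambda>n. Im (cpair (act A (\<sigma> * int n) x) (w j))) \<longlonglongrightarrow> 0"
      by (auto dest: tendsto_Re tendsto_Im)
    with c show "(\<lambda>n. act A (\<sigma> * int n) x $ i) \<longlonglongrightarrow> 0 $ i" by auto
  qed
  from ev show "\<exists>S. cross_section A S \<and> bounded S"
  proof
    assume "\<forall>z. complex_eigenvalue A z \<longrightarrow> cmod z > 1"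
    then have "(\<lambda>n. act A (- 1 * int n) x) \<longlonglongrightarrow> 0" for x
      by (intro lim) (simp add: jordan_chain_tendsto_0_inverse[OF A] jordan_chain_imp_eigenvalue)
    then show ?thesis by (rule bounded_cross_section[OF A S])
  next
    assume "\<forall>z. complex_eigenvalue A z \<longrightarrow> cmod z < 1"
    then have "(\<lambda>n. act A (1 * int n) x) \<longlonglongrightarrow> 0" for x
      by (intro lim) (simp add: jordan_chain_tendsto_0[OF A] jordan_chain_imp_eigenvalue)
    then show ?thesis by (rule bounded_cross_section[OF A S])
  qed
qed

lemma cross_section_iff_not_orthogonal:
  fixes A :: "real^'n::{finite,linorder}^'n::{finite,linorder}"
  assumes A: "invertible A" and J: "real_jordan_normal_form A"
  shows "(\<exists>S. cross_section A S) \<longleftrightarrow> \<not> orthogonal_matrix A"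
proof
  assume "\<exists>S. cross_section A S"
  then show "\<not> orthogonal_matrix A" using orthogonal_no_cross_section[OF A] by blast
next
  assume "\<not> orthogonal_matrix A"
  from jordan_chain_nonorthogonal[OF J this] obtain \<mu> m w
    where w: "jordan_chain A \<mu> m w" and *: "cmod \<mu> \<noteq> 1 \<or> m \<noteq> 1" by blast
  have w0: "w 0 \<noteq> 0" "cmat A *v w 0 = \<mu> *s w 0" using w by (auto simp: jordan_chain_def)
  show "\<exists>S. cross_section A S"
  proof (cases "cmod \<mu> = 1")
    case False
    then show ?thesis by (rule cross_section_of_eigenvector[OF A w0])
  next
    case True
    \<comment> \<open>On the unit circle the chain must be longer than one, and its second vector is
      the generalized eigenvector.\<close>
    with * w have "Suc 0 < m" by (auto simp: jordan_chain_def)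
    with w have "cmat A *v w (Suc 0) = \<mu> *s w (Suc 0) + w 0" by (auto simp: jordan_chain_def)
    then show ?thesis by (rule cross_section_of_generalized_eigenvector[OF A w0])
  qed
qed

theorem theorem4:
  fixes A :: "real^'n::{finite,linorder}^'n::{finite,linorder}"
  assumes "invertible A"
    and "real_jordan_normal_form A"
  shows "((\<exists>S. cross_section A S) \<longleftrightarrow> \<not> orthogonal_matrix A) \<and>
    ((\<exists>S. cross_section A S \<and> emeasure lebesgue S < \<infinity>) \<longleftrightarrow> \<bar>Determinants.det A\<bar> \<noteq> 1) \<and>
    ((\<exists>S. cross_section A S \<and> bounded S) \<longleftrightarrow>
       (\<forall>z. complex_eigenvalue A z \<longrightarrow> cmod z > 1) \<or>
       (\<forall>z. complex_eigenvalue A z \<longrightarrow> cmod z < 1))"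
proof (intro conjI cross_section_iff_not_orthogonal bounded_cross_section_iff_eigenvalues assms)
  show "(\<exists>S. cross_section A S \<and> emeasure lebesgue S < \<infinity>) \<longleftrightarrow> \<bar>Determinants.det A\<bar> \<noteq> 1"
  proof
    assume "\<exists>S. cross_section A S \<and> emeasure lebesgue S < \<infinity>"
    then show "\<bar>Determinants.det A\<bar> \<noteq> 1"
      using infinite_cross_section[OF assms(1)] by (metis less_irrefl)
  next
    assume det: "\<bar>Determinants.det A\<bar> \<noteq> 1"
    \<comment> \<open>The cross-section to be cut into pieces comes from the first equivalence, as
      an orthogonal matrix has determinant 1 or -1.\<close>
    then have "\<not> orthogonal_matrix A" using det_orthogonal_matrix[of A] by auto
    then obtain S where "cross_section A S"
      using cross_section_iff_not_orthogonal[OF assms] by blast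
    from finite_cross_section[OF assms(1) det this]
    show "\<exists>S. cross_section A S \<and> emeasure lebesgue S < \<infinity>" .
  qed
qed

end
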